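(* Let $s$ be an odd prime, $p=2$, $q\ge2$ and $n=p+q+1$. Then the following $(p+q)\times n$ matrix $\mathcal{G}$ over $\mathrm{GF}(s)$, whose first $2$ rows form $\mathcal{G}_c$ and whose last $q$ rows form $\mathcal{G}_r$, yields a 2fi-optimal $s^{n-1}$ fractional factorial row-column design (in an $s^p\times s^q$ array). (a) For $q=2$: $$\mathcal{G}=\left(\begin{array}{ccc} I_2 & M & \boldsymbol{a}\\ \hline I_2 & M+I_2 & \boldsymbol{b}\end{array}\right),$$ where $\boldsymbol{a}=(1,2)^T$, $\boldsymbol{b}=(2,0)^T$, $M=\begin{pmatrix}1&1\\2&1\end{pmatrix}$ if $s=3$, and $\boldsymbol{a}=(1,1)^T$, $\boldsymbol{b}=(2,2)^T$, $M=\begin{pmatrix}1&1\\3&2\end{pmatrix}$ otherwise. (b) For $q=3$: $$\mathcal{G}=\left(\begin{array}{cccc} I_2 & M & \boldsymbol{a} & \boldsymbol{b}\\ \hline I_2 & M+I_2 & \boldsymbol{e}_1 & \boldsymbol{0}_{2\times1}\\ \boldsymbol{0}_{1\times2} & \boldsymbol{0}_{1\times2} & 1 & 1\end{array}\right),$$ where $M=\begin{pmatrix}1&1\\2&1\end{pmatrix}$, $\boldsymbol{a}=(1,s-2)^T$ and $\boldsymbol{b}=(1,s-1)^T$. (c) For $q=4$: $$\mathcal{G}=\left(\begin{array}{ccccc} I_2 & M & \boldsymbol{a} & \boldsymbol{b} & \boldsymbol{c}\\ \hline I_2 & M+I_2 & \boldsymbol{e}_2 & \boldsymbol{0}_{2\times1}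 & \boldsymbol{0}_{2\times1}\\ \boldsymbol{0}_{2\times2} & \boldsymbol{0}_{2\times2} & \boldsymbol{1}_2 & \boldsymbol{e}_1+2\boldsymbol{e}_2 & \boldsymbol{e}_2\end{array}\right),$$ where $M=\begin{pmatrix}1&1\\2&1\end{pmatrix}$, $\boldsymbol{a}=(1,s-1)^T$, $\boldsymbol{b}=(1,s-2)^T$ and $\boldsymbol{c}=(1,s-3)^T$. (d) For $q\ge5$: $$\mathcal{G}=\left(\begin{array}{cccc} I_2 & M & \boldsymbol{a} & X_*\\ \hline I_2 & M+I_2 & \boldsymbol{a} & \boldsymbol{0}_{2\times(q-2)}\\ \boldsymbol{0}_{(q-2)\times2} & \boldsymbol{0}_{(q-2)\times2} & \boldsymbol{1}_{q-2} & I_{q-2}\end{array}\right),$$ where $M=\begin{pmatrix}1&1\\2&1\end{pmatrix}$, $\boldsymbol{a}=(1,s-1)^T$, and $X_*$ is a $2\times(q-2)$ matrix, with no zero column, selected so that each point of $\mathrm{PG}(1,s)$ appears among the columns of the $2\times n$ matrix $(I_2\;\;M\;\;\boldsymbol{a}\;\;X_* )$ either $\alpha$ or $\alpha+1$ times, where $\alpha=\lfloor n/(s+1)\rfloor$.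
   Context: Matrices. $s$ is a prime and all matrices have entries in $\mathrm{GF}(s)=\mathbb{Z}/s$ (integers are reduced mod $s$). $I_v$ is the $v\times v$ identity, $\boldsymbol{1}_v$ the $v\times1$ all-ones vector, $\boldsymbol{0}_{v\times w}$ the zero matrix, and $\boldsymbol{e}_i$ the column vector (of the length dictated by its block) with $i$-th entry $1$ and other entries $0$. $\mathrm{PG}(m-1,s)$ is the set of 1-dimensional subspaces ("points") of $\mathrm{GF}(s)^m$; a nonzero column vector belongs to (is an appearance of) the point it spans. Designs. Let $p,q\ge1$, $p+q\le n$. An array generator matrix is a $(p+q)\times n$ matrix $\mathcal{G}$ over $\mathrm{GF}(s)$ of full row rank $p+q$; $\mathcal{G}_c$ denotes its first $p$ rows, $\mathcal{G}_r$ its last $q$ rows, and $\mathcal{G}_i,\mathcal{G}_{c,i},\mathcal{G}_{r,i}$ the $i$-th columns of $\mathcal{G},\mathcal{G}_c,\mathcal{G}_r$. If $\boldsymbol{x}_1,\dots,\boldsymbol{x}_{s^p}$ are the vectors of the row space of $\mathcal{G}_c$ and $\boldsymbol{y}_1,\dots,\boldsymbol{y}_{s^q}$ those of the row space of $\mathcal{G}_r$ (with $\boldsymbol{x}_1=\boldsymbol{y}_1=0$), $\mathcal{G}$ yields the $s^p\times s^q$ row-column design whose cell $(i,j)$ carries the level combination $d[i,j]=\boldsymbol{x}_i+\boldsymbol{y}_j\in\mathrm{GF}(s)^n$ of the $n$ factors $F_1,\dots,F_n$. It is an $s^n$ full factorial design when $p+q=n$, and an $s^{n-k}$ fractional factorial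 design when $p+q=n-k<n$. Model and confounding. $Y_{ij}=\mu+\tau_i+\rho_j+\gamma_{d[i,j]}+\varepsilon_{ij}$, with row effects $\tau_i$, column effects $\rho_j$, uncorrelated mean-zero errors of variance $\sigma^2$, and $\gamma_{(x_1,\dots,x_n)}=\sum_l\alpha_{l,x_l}+\sum_{l<m}\sum_{v=1}^{s-1}\beta^{(v)}_{lm,\,x_l+vx_m}$, where $\sum_u\alpha_{l,u}=0$ and $\sum_u\beta^{(v)}_{lm,u}=0$. A main effect $F_l$ is unconfounded if the estimators of the $\alpha_{l,u}$ are uncorrelated with all other estimators in the model; the two-factor interaction (2fi) $F_l\times F_m$ is unconfounded if for every $v=1,\dots,s-1$ the estimators of the $\beta^{(v)}_{lm,u}$ are uncorrelated with all other estimators in the model. Interactions of three or more factors are assumed negligible. Equivalent algebraic criterion (known result, Zhou and Zhou 2023), usable as the definition of confounding. A main effect or 2fi is confounded with another main effect or 2fi iff the columns of $\mathcal{G}$ corresponding to the (distinct) factors involved in the two effects are linearly dependent. If $\mathcal{G}_i\ne0$, $F_i$ is confounded with column effects iff $\mathcal{G}_{c,i}=0$, and with row effects iff $\mathcal{G}_{r,i}=0$. If $\mathcal{G}_i,\mathcal{G}_j$ are linearly independent, $F_i\times F_j$ is confounded with column effects iff $\mathcal{G}_{c,i},\mathcal{G}_{c,j}$ are linearly dependent, and with row effects iff $\mathcal{G}_{r,i},\mathcal{G}_{r,j}$ are linearly dependent. An effect is unconfounded iff none of these confoundings occurs. 2fi-optimality. The design yielded by $\mathcal{G}$ is 2fi-optimal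 if all main effects are unconfounded and the number of unconfounded 2fi's is maximum among all designs yielded by array generator matrices with the same $(s,p,q,n)$ for which all main effects are unconfounded. *)

theory Defs
  imports
    "Jordan_Normal_Form.DL_Rank"
    "Berlekamp_Zassenhaus.Finite_Field"
begin

text \<open>
  Throughout, \<open>'s mod_ring\<close> with \<open>'s :: prime_card\<close> is the field \<open>GF(s) = \<int>/s\<close> for the prime
  \<open>s = CARD('s)\<close>. Rows, columns and factors are numbered from \<open>0\<close>.
\<close>

definition array_generator :: "nat \<Rightarrow> nat \<Rightarrow> nat \<Rightarrow> 's::prime_card mod_ring mat \<Rightarrow> bool" where
  "array_generator p q n G \<longleftrightarrow>
     1 \<le> p \<and> 1 \<le> q \<and> p + q \<le> n \<and>
     G \<in> carrier_mat (p + q) n \<and> vec_space.rank (p + q) G = p + q"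

definition gen_c :: "nat \<Rightarrow> 'a mat \<Rightarrow> 'a mat" where
  "gen_c p G = mat p (dim_col G) (\<lambda>(i, j). G $$ (i, j))"

definition gen_r :: "nat \<Rightarrow> 'a mat \<Rightarrow> 'a mat" where
  "gen_r p G = mat (dim_row G - p) (dim_col G) (\<lambda>(i, j). G $$ (p + i, j))"

text \<open>
  Linear dependence of the family of columns indexed by a finite set \<open>J\<close>. The coefficients are
  attached to indices and not to vectors: two equal columns at different indices are dependent,
  whereas the library predicate \<open>lin_dep\<close>, applied to the set of columns, would identify them.
\<close>

definition cols_dependent :: "'a::field mat \<Rightarrow> nat set \<Rightarrow> bool" where
  "cols_dependent A J \<longleftrightarrow>
     (\<exists>c. (\<exists>j\<in>J. c j \<noteq> 0) \<and> (\<forall>i<dim_row A. (\<Sum>j\<in>J. c j * A $$ (i, j)) = 0))"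

lemma cols_dependent_singleton:
  assumes "j < dim_col A"
  shows "cols_dependent A {j} \<longleftrightarrow> col A j = 0\<^sub>v (dim_row A)"
proof
  assume "cols_dependent A {j}"
  then show "col A j = 0\<^sub>v (dim_row A)"
    using assms by (auto simp: cols_dependent_def intro!: eq_vecI)
next
  assume z: "col A j = 0\<^sub>v (dim_row A)"
  have "A $$ (i, j) = 0" if "i < dim_row A" for i
    using that assms index_col[of i A j] unfolding z by simp
  then show "cols_dependent A {j}"
    unfolding cols_dependent_def by (intro exI[of _ "\<lambda>_. 1"]) simp
qed

text \<open>
  An effect is represented by the set of factors it involves: \<open>{l}\<close> is the main effect of factor
  \<open>l\<close>, and \<open>{l, m}\<close> with \<open>l \<noteq> m\<close> is the two-factor interaction of \<open>l\<close> and \<open>m\<close>.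
\<close>

definition main_effects :: "nat \<Rightarrow> nat set set" where
  "main_effects n = {{l} | l. l < n}"

definition two_factor_interactions :: "nat \<Rightarrow> nat set set" where
  "two_factor_interactions n = {{l, m} | l m. l < m \<and> m < n}"

text \<open>
  Confounding is defined by the algebraic criterion of Zhou and Zhou (2023). For a main effect,
  \<open>cols_dependent\<close> says that the column of \<open>gen_c\<close> (or \<open>gen_r\<close>) is zero, by
  \<open>cols_dependent_singleton\<close>. The criterion for row and column effects presupposes that the columns
  of \<open>G\<close> itself belonging to the effect are independent; if they are dependent, then (for \<open>n \<ge> 2\<close>)
  the effect is confounded with a main effect anyway, so \<open>unconfounded\<close> is not affected.
\<close>

definition confounded_with_effect :: "'s::prime_card mod_ring mat \<Rightarrow> nat set \<Rightarrow> nat set \<Rightarrow> bool" where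
  "confounded_with_effect G E E' \<longleftrightarrow> cols_dependent G (E \<union> E')"

definition confounded_with_columns :: "nat \<Rightarrow> 's::prime_card mod_ring mat \<Rightarrow> nat set \<Rightarrow> bool" where
  "confounded_with_columns p G E \<longleftrightarrow> cols_dependent (gen_c p G) E"

definition confounded_with_rows :: "nat \<Rightarrow> 's::prime_card mod_ring mat \<Rightarrow> nat set \<Rightarrow> bool" where
  "confounded_with_rows p G E \<longleftrightarrow> cols_dependent (gen_r p G) E"

definition unconfounded :: "nat \<Rightarrow> 's::prime_card mod_ring mat \<Rightarrow> nat set \<Rightarrow> bool" where
  "unconfounded p G E \<longleftrightarrow>
     (\<forall>E' \<in> main_effects (dim_col G) \<union> two_factor_interactions (dim_col G).
        E' \<noteq> E \<longrightarrow> \<not> confounded_with_effect G E E') \<and>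
     \<not> confounded_with_columns p G E \<and>
     \<not> confounded_with_rows p G E"

definition main_effects_unconfounded :: "nat \<Rightarrow> 's::prime_card mod_ring mat \<Rightarrow> bool" where
  "main_effects_unconfounded p G \<longleftrightarrow> (\<forall>E \<in> main_effects (dim_col G). unconfounded p G E)"

definition num_unconfounded_2fi :: "nat \<Rightarrow> 's::prime_card mod_ring mat \<Rightarrow> nat" where
  "num_unconfounded_2fi p G = card {E \<in> two_factor_interactions (dim_col G). unconfounded p G E}"

text \<open>
  The array generator matrix \<open>G\<close> yields the \<open>s ^ p \<times> s ^ q\<close> design whose cells carry the sums of
  a vector of the row space of \<open>gen_c p G\<close> and a vector of the row space of \<open>gen_r p G\<close>; it is an
  \<open>s ^ (p + q)\<close> factorial design in \<open>n\<close> factors. Optimality of this design is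
  expressed through \<open>G\<close>, and the competitors range over all array generator matrices with the same
  \<open>(s, p, q, n)\<close>.
\<close>

definition yields_2fi_optimal ::
    "nat \<Rightarrow> nat \<Rightarrow> nat \<Rightarrow> 's::prime_card mod_ring mat \<Rightarrow> bool" where
  "yields_2fi_optimal p q n G \<longleftrightarrow>
     array_generator p q n G \<and> main_effects_unconfounded p G \<and>
     (\<forall>G' :: 's mod_ring mat.
        array_generator p q n G' \<and> main_effects_unconfounded p G' \<longrightarrow>
        num_unconfounded_2fi p G' \<le> num_unconfounded_2fi p G)"

text \<open>The argument \<open>m\<close> of \<open>PG_points\<close> is the vector space dimension, so \<open>PG_points m\<close> is
  \<open>PG(m - 1, s)\<close>.\<close>

definition PG_points :: "nat \<Rightarrow> 's::prime_card mod_ring vec set set" where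
  "PG_points m =
     {W. VectorSpace.subspace class_ring W (module_vec TYPE('s mod_ring) m) \<and>
         vectorspace.dim class_ring ((module_vec TYPE('s mod_ring) m)\<lparr>carrier := W\<rparr>) = 1}"

definition appearances :: "'s::prime_card mod_ring mat \<Rightarrow> 's mod_ring vec set \<Rightarrow> nat" where
  "appearances A W = card {j. j < dim_col A \<and> col A j \<noteq> 0\<^sub>v (dim_row A) \<and> col A j \<in> W}"

definition append_cols :: "'a::zero mat \<Rightarrow> 'a mat \<Rightarrow> 'a mat" (infixr \<open>@\<^sub>c\<close> 66) where
  "A @\<^sub>c B = four_block_mat A B (0\<^sub>m 0 (dim_col A)) (0\<^sub>m 0 (dim_col B))"

abbreviation column :: "'a list \<Rightarrow> 'a mat" where
  "column xs \<equiv> mat_of_cols_list (length xs) [xs]"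

definition ones :: "nat \<Rightarrow> 'a::one mat" where
  "ones v = mat v 1 (\<lambda>_. 1)"

definition M0 :: "'s::prime_card mod_ring mat" where
  "M0 = mat_of_rows_list 2 [[1, 1], [2, 1]]"

definition G_q2 :: "'s::prime_card mod_ring mat" where
  "G_q2 =
    (let a = (if CARD('s) = 3 then column [1, 2] else column [1, 1]);
         b = (if CARD('s) = 3 then column [2, 0] else column [2, 2]);
         M = (if CARD('s) = 3 then M0 else mat_of_rows_list 2 [[1, 1], [3, 2]])
     in (1\<^sub>m 2 @\<^sub>c M           @\<^sub>c a) @\<^sub>r
        (1\<^sub>m 2 @\<^sub>c (M + 1\<^sub>m 2) @\<^sub>c b))"

definition G_q3 :: "'s::prime_card mod_ring mat" where
  "G_q3 =
    (let a = column [1, of_nat (CARD('s) - 2)];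
         b = column [1, of_nat (CARD('s) - 1)]
     in (1\<^sub>m 2   @\<^sub>c M0           @\<^sub>c a             @\<^sub>c b) @\<^sub>r
        (1\<^sub>m 2   @\<^sub>c (M0 + 1\<^sub>m 2) @\<^sub>c column [1, 0] @\<^sub>c 0\<^sub>m 2 1) @\<^sub>r
        (0\<^sub>m 1 2 @\<^sub>c 0\<^sub>m 1 2       @\<^sub>c column [1]    @\<^sub>c column [1]))"

definition G_q4 :: "'s::prime_card mod_ring mat" where
  "G_q4 =
    (let a = column [1, of_nat (CARD('s) - 1)];
         b = column [1, of_nat (CARD('s) - 2)];
         c = column [1, of_nat (CARD('s) - 3)]
     in (1\<^sub>m 2   @\<^sub>c M0           @\<^sub>c a             @\<^sub>c b             @\<^sub>c c) @\<^sub>r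
        (1\<^sub>m 2   @\<^sub>c (M0 + 1\<^sub>m 2) @\<^sub>c column [0, 1] @\<^sub>c 0\<^sub>m 2 1       @\<^sub>c 0\<^sub>m 2 1) @\<^sub>r
        (0\<^sub>m 2 2 @\<^sub>c 0\<^sub>m 2 2       @\<^sub>c ones 2        @\<^sub>c column [1, 2] @\<^sub>c column [0, 1]))"

definition a_ge5 :: "'s::prime_card mod_ring mat" where
  "a_ge5 = column [1, of_nat (CARD('s) - 1)]"

definition G_ge5 :: "nat \<Rightarrow> 's::prime_card mod_ring mat \<Rightarrow> 's mod_ring mat" where
  "G_ge5 q X =
     (1\<^sub>m 2         @\<^sub>c M0           @\<^sub>c a_ge5      @\<^sub>c X) @\<^sub>r
     (1\<^sub>m 2         @\<^sub>c (M0 + 1\<^sub>m 2) @\<^sub>c a_ge5      @\<^sub>c 0\<^sub>m 2 (q - 2)) @\<^sub>r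
     (0\<^sub>m (q - 2) 2 @\<^sub>c 0\<^sub>m (q - 2) 2 @\<^sub>c ones (q - 2) @\<^sub>c 1\<^sub>m (q - 2))"

definition admissible_X :: "nat \<Rightarrow> 's::prime_card mod_ring mat \<Rightarrow> bool" where
  "admissible_X q X \<longleftrightarrow>
     X \<in> carrier_mat 2 (q - 2) \<and>
     (\<forall>j < q - 2. col X j \<noteq> 0\<^sub>v 2) \<and>
     (\<forall>W \<in> PG_points 2.
        let n = 2 + q + 1; \<alpha> = n div (CARD('s) + 1)
        in appearances (1\<^sub>m 2 @\<^sub>c M0 @\<^sub>c a_ge5 @\<^sub>c X) W \<in> {\<alpha>, \<alpha> + 1})"

end

theory Submission
  imports Defs
begin

text \<open>
  The number of factors exceeds the number of rows of a generator by one, so the columns of a generator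
  of full rank satisfy a single linear relation up to scalars. If this relation involves at least five
  columns, no main effect or two-factor interaction is confounded with another one, since two effects
  involve at most four factors. Interactions are then lost only to the columns or to the rows of
  the array.

  The upper part of a generator has two rows. Its columns are nonzero whenever all main effects are
  unconfounded, so they represent points of the projective line, which has s + 1 points, and an
  interaction is confounded with column effects iff its two factors sit at the same point. The number of
  pairs at a common point is smallest when the factors are spread evenly over the points
  (\<open>balanced_minimises_collisions\<close>), and this bounds every competitor. A generator is therefore optimal
  if its relation has weight at least five, the columns of its lower part are pairwise independent, and its
  points are evenly spread (\<open>optimal_if_balanced\<close>).

  All generators have the same block form (\<open>stacked_generator\<close>), in which the relation, the rank and the
  dependent pairs of the lower part are read off from the small blocks in the last columns. The three conditions
  then become short computations, which also cover the small primes where points start to coincide.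
  For q at least 5 the even spread is the condition imposed on X, once points as subspaces are
  translated into slopes (\<open>PG_points_2_eq\<close>); a suitable X exists because an evenly spread list of points
  can always be prolonged (\<open>balanced_list_extend\<close>).

  The exception is q = 2 over GF(3). There the lower part also has only two rows, and five
  columns on four points force a coincidence in each part. The generator has exactly one in each part, at
  different pairs, and keeps eight of the ten interactions. A competitor could do better only if the
  coincidences in both parts occurred at the same pair and nothing else was confounded. The
  relation would then involve all five columns, and since in each part the remaining three columns lie on the
  other three points, the arithmetic of GF(3) would make the two terms of the coinciding pair cancel. The
  two columns would be dependent, and two main effects confounded (\<open>GF3_num_unconfounded_2fi_le_8\<close>).
\<close>

section \<open>Even distributions minimise coincidences\<close>

lemma two_factor_interactions_eq:
  "two_factor_interactions n = {E. E \<subseteq> {..<n} \<and> card E = 2}"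
proof (intro equalityI subsetI)
  fix E assume "E \<in> {E. E \<subseteq> {..<n} \<and> card E = 2}"
  then obtain l m where E: "E = {l, m}" "l \<noteq> m" "l < n" "m < n"
    by (auto simp: card_2_iff)
  then have "E = {min l m, max l m}" "min l m < max l m" "max l m < n"
    by (auto simp: min_def max_def)
  then show "E \<in> two_factor_interactions n"
    unfolding two_factor_interactions_def by blast
qed (auto simp: two_factor_interactions_def)

lemma two_factor_interactionsI:
  "l \<noteq> m \<Longrightarrow> l < n \<Longrightarrow> m < n \<Longrightarrow> {l, m} \<in> two_factor_interactions n"
  by (simp add: two_factor_interactions_eq)

lemma two_factor_interactionsE:
  assumes "E \<in> two_factor_interactions n"
  obtains l m where "E = {l, m}" "l < m" "m < n"
  using assms by (auto simp: two_factor_interactions_def)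

lemma finite_two_factor_interactions [simp]: "finite (two_factor_interactions n)"
  by (simp add: two_factor_interactions_eq)

lemma card_two_factor_interactions: "card (two_factor_interactions n) = n choose 2"
  unfolding two_factor_interactions_eq using n_subsets[of "{..<n}" 2] by simp

text \<open>
  With f assigning to each factor the point of the projective line spanned by its column of the
  \<open>gen_c\<close> part, these are the interactions confounded with column effects.
\<close>

definition collisions :: "nat \<Rightarrow> (nat \<Rightarrow> 'k) \<Rightarrow> nat set set" where
  "collisions n f = {E \<in> two_factor_interactions n. \<exists>t. \<forall>j\<in>E. f j = t}"

lemma collisions_subset: "collisions n f \<subseteq> two_factor_interactions n"
  by (auto simp: collisions_def)

lemma finite_collisions [simp]: "finite (collisions n f)"
  by (rule finite_subset[OF collisions_subset]) simp

lemma card_collisions: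
  fixes f :: "nat \<Rightarrow> 'k::finite"
  shows "card (collisions n f) = (\<Sum>t\<in>UNIV. card {j. j < n \<and> f j = t} choose 2)"
proof -
  let ?F = "\<lambda>t. {j. j < n \<and> f j = t}"
  have "collisions n f = (\<Union>t. {E. E \<subseteq> ?F t \<and> card E = 2})"
    by (auto simp: collisions_def two_factor_interactions_eq)
  also have "card \<dots> = (\<Sum>t\<in>UNIV. card {E. E \<subseteq> ?F t \<and> card E = 2})"
  proof (rule card_UN_disjoint)
    show "\<forall>t\<in>UNIV. \<forall>u\<in>UNIV. t \<noteq> u \<longrightarrow>
        {E. E \<subseteq> ?F t \<and> card E = 2} \<inter> {E. E \<subseteq> ?F u \<and> card E = 2} = {}"
    proof (intro ballI impI equals0I)
      fix t u E
      assume "t \<noteq> u" and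
        "E \<in> {E. E \<subseteq> ?F t \<and> card E = 2} \<inter> {E. E \<subseteq> ?F u \<and> card E = 2}"
      then show False by (cases "E = {}") auto
    qed
  qed auto
  also have "\<dots> = (\<Sum>t\<in>UNIV. card (?F t) choose 2)"
    by (intro sum.cong refl n_subsets) simp
  finally show ?thesis .
qed

lemma sum_card_fibres:
  fixes f :: "nat \<Rightarrow> 'k::finite"
  shows "(\<Sum>t\<in>UNIV. card {j. j < n \<and> f j = t}) = n"
proof -
  have "(\<Sum>t\<in>UNIV. card {j. j < n \<and> f j = t}) = card (\<Union>t. {j. j < n \<and> f j = t})"
    by (intro card_UN_disjoint [symmetric]) auto
  also have "(\<Union>t. {j. j < n \<and> f j = t}) = {..<n}" by auto
  finally show ?thesis by simp
qed

text \<open>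
  The binomial coefficient is a convex function of x; the last two summands form the line
  through its values at a and a + 1, and the first summand is the excess over this line. It
  vanishes exactly at a and a + 1.
\<close>

lemma choose_two_tangent:
  "2 * int (x choose 2) = (int x - int a) * (int x - int a - 1) + 2 * int a * int x - int a * (int a + 1)"
proof -
  have "2 * (x choose 2) = x * (x - 1)"
    unfolding choose_two by (intro dvd_mult_div_cancel) auto
  then have "2 * int (x choose 2) = int (x * (x - 1))"
    by (metis of_nat_mult of_nat_numeral)
  also have "\<dots> = int x * (int x - 1)"
    by (cases x) (auto simp: algebra_simps)
  finally show ?thesis by (simp add: algebra_simps)
qed

lemma int_mult_pred_nonneg: "0 \<le> (z::int) * (z - 1)"
  by (cases "z \<le> 0") (auto intro: mult_nonneg_nonneg mult_nonpos_nonpos)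

text \<open>
  The line through the points a and a + 1 of the graph of the binomial coefficient supports the
  graph from below. The sum of this line over all fibre sizes depends on n alone, because the
  fibre sizes add up to n; it equals the number of collisions if all fibres have a or a + 1
  elements, and bounds it from below in any case.
\<close>

lemma balanced_minimises_collisions:
  fixes f g :: "nat \<Rightarrow> 'k::finite"
  assumes bal: "\<And>t. card {j. j < n \<and> f j = t} \<in> {a, a + 1}"
  shows "card (collisions n f) \<le> card (collisions n g)"
proof -
  \<comment> \<open>T h t is the supporting line at the size of the fibre of h over t, scaled by 2.\<close>
  define T :: "(nat \<Rightarrow> 'k) \<Rightarrow> 'k \<Rightarrow> int" where
    "T h t = 2 * int a * int (card {j. j < n \<and> h j = t}) - int a * (int a + 1)" for h t
  have T: "(\<Sum>t\<in>UNIV. T h t) = 2 * int a * int n - int CARD('k) * (int a * (int a + 1))" for h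
  proof -
    have "(\<Sum>t\<in>UNIV. T h t) = 2 * int a * int (\<Sum>t\<in>UNIV. card {j. j < n \<and> h j = t})
        - int CARD('k) * (int a * (int a + 1))"
      by (simp add: T_def sum_subtractf sum_distrib_left)
    then show ?thesis by (simp only: sum_card_fibres)
  qed
  have "2 * int (card (collisions n f)) = (\<Sum>t\<in>UNIV. T f t)"
  proof -
    have "2 * int (card {j. j < n \<and> f j = t} choose 2) = T f t" for t
      using bal[of t] unfolding choose_two_tangent[of _ a] T_def by auto
    then show ?thesis by (simp add: card_collisions sum_distrib_left)
  qed
  also have "\<dots> = (\<Sum>t\<in>UNIV. T g t)" by (simp only: T)
  also have "\<dots> \<le> 2 * int (card (collisions n g))"
  proof -
    have "T g t \<le> 2 * int (card {j. j < n \<and> g j = t} choose 2)" for t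
      unfolding choose_two_tangent[of _ a] T_def
      using int_mult_pred_nonneg[of "int (card {j. j < n \<and> g j = t}) - int a"] by simp
    then show ?thesis by (simp add: card_collisions sum_distrib_left sum_mono)
  qed
  finally show ?thesis by simp
qed

text \<open>
  Turns a fibre size into a count in an explicit list, where it can be evaluated.
\<close>

lemma card_fibre_eq_count:
  "card {j. j < n \<and> f j = t} = length (filter (\<lambda>x. x = t) (map f [0..<n]))"
  unfolding length_filter_conv_card by (rule arg_cong[of _ _ card]) auto

lemma balanced_if_distinct:
  assumes "distinct (map f [0..<n])"
  shows "card {j. j < n \<and> f j = t} \<in> {0, 0 + 1}"
proof -
  have "inj_on f {..<n}"
    using assms by (simp add: distinct_map atLeast0LessThan)
  then have "card {j. j < n \<and> f j = t} \<le> Suc 0"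
    by (subst card_le_Suc0_iff_eq) (auto simp: inj_on_def)
  moreover have "m \<in> {0, 0 + 1}" if "m \<le> Suc 0" for m :: nat using that by auto
  ultimately show ?thesis by blast
qed

section \<open>Linear dependence of columns\<close>

lemma cols_dependent_pair:
  assumes "l \<noteq> m"
  shows "cols_dependent A {l, m} \<longleftrightarrow>
    (\<exists>a b. (a \<noteq> 0 \<or> b \<noteq> 0) \<and> (\<forall>i<dim_row A. a * A $$ (i, l) + b * A $$ (i, m) = 0))"
proof
  assume "cols_dependent A {l, m}"
  then show "\<exists>a b. (a \<noteq> 0 \<or> b \<noteq> 0) \<and> (\<forall>i<dim_row A. a * A $$ (i, l) + b * A $$ (i, m) = 0)"
    using assms by (auto simp: cols_dependent_def)
next
  assume "\<exists>a b. (a \<noteq> 0 \<or> b \<noteq> 0) \<and> (\<forall>i<dim_row A. a * A $$ (i, l) + b * A $$ (i, m) = 0)"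
  then obtain a b where "a \<noteq> 0 \<or> b \<noteq> 0" "\<forall>i<dim_row A. a * A $$ (i, l) + b * A $$ (i, m) = 0"
    by blast
  then show "cols_dependent A {l, m}"
    unfolding cols_dependent_def using assms
    by (intro exI[of _ "\<lambda>j. if j = l then a else b"]) auto
qed

lemma cols_dependent_mono:
  assumes "cols_dependent A J" "J \<subseteq> K" "finite K"
  shows "cols_dependent A K"
proof -
  obtain c where c: "\<exists>j\<in>J. c j \<noteq> 0" "\<forall>i<dim_row A. (\<Sum>j\<in>J. c j * A $$ (i, j)) = 0"
    using assms(1) by (auto simp: cols_dependent_def)
  have "(\<Sum>j\<in>K. (if j \<in> J then c j else 0) * A $$ (i, j)) = (\<Sum>j\<in>J. c j * A $$ (i, j))" for i
    using assms(2,3) by (intro sum.mono_neutral_cong_right) auto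
  with c assms(2) show ?thesis
    unfolding cols_dependent_def by (intro exI[of _ "\<lambda>j. if j \<in> J then c j else 0"]) auto
qed

lemma independent_if_pair_independent:
  assumes "\<not> cols_dependent A {l, m}"
  shows "\<not> cols_dependent A {l}" "\<not> cols_dependent A {m}"
  using assms cols_dependent_mono[of A "{l}" "{l, m}"] cols_dependent_mono[of A "{m}" "{l, m}"] by auto

text \<open>
  The point of the projective line spanned by a nonzero vector (x, y), in the affine coordinate
  y / x; the value \<open>None\<close> is the point at infinity. So the points are the elements of the option
  type over the field.
\<close>

definition slope :: "'a::field \<Rightarrow> 'a \<Rightarrow> 'a option" where
  "slope x y = (if x = 0 then None else Some (y / x))"

lemma slope_eq_iff:
  assumes "x \<noteq> 0 \<or> y \<noteq> 0" "x' \<noteq> 0 \<or> y' \<noteq> 0"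
  shows "slope x y = slope x' y' \<longleftrightarrow> x * y' = x' * y"
proof (cases "x = 0 \<or> x' = 0")
  case True
  with assms show ?thesis by (auto simp: slope_def)
next
  case False
  then have "slope x y = slope x' y' \<longleftrightarrow> y * x' = y' * x"
    by (simp add: slope_def frac_eq_eq)
  then show ?thesis by (metis mult.commute)
qed

text \<open>
  Any relation between the two vectors, multiplied out with Cramer's rule, makes the determinant
  annihilate both coefficients; conversely a vanishing determinant provides the coefficients of
  a relation, taken from the coordinate in which they do not both vanish.
\<close>

lemma plane_vectors_dependent_iff:
  fixes x y x' y' :: "'a::field"
  assumes "x \<noteq> 0 \<or> y \<noteq> 0" "x' \<noteq> 0 \<or> y' \<noteq> 0"
  shows "(\<exists>a b. (a \<noteq> 0 \<or> b \<noteq> 0) \<and> a * x + b * x' = 0 \<and> a * y + b * y' = 0) \<longleftrightarrow>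
    x * y' = x' * y"
proof
  assume "\<exists>a b. (a \<noteq> 0 \<or> b \<noteq> 0) \<and> a * x + b * x' = 0 \<and> a * y + b * y' = 0"
  then obtain a b where ab: "a \<noteq> 0 \<or> b \<noteq> 0" "a * x + b * x' = 0" "a * y + b * y' = 0" by blast
  have "a * (x * y' - x' * y) = (a * x + b * x') * y' - (a * y + b * y') * x'"
    "b * (x * y' - x' * y) = (a * y + b * y') * x - (a * x + b * x') * y"
    by (simp_all add: algebra_simps)
  then have "a * (x * y' - x' * y) = 0" "b * (x * y' - x' * y) = 0"
    unfolding ab(2,3) by simp_all
  with ab(1) show "x * y' = x' * y" by auto
next
  assume *: "x * y' = x' * y"
  show "\<exists>a b. (a \<noteq> 0 \<or> b \<noteq> 0) \<and> a * x + b * x' = 0 \<and> a * y + b * y' = 0"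
  proof (cases "x = 0")
    case True
    then have "y \<noteq> 0" using assms(1) by simp
    moreover have "x' * y = 0" using *[symmetric] True by (simp only: mult_zero_left)
    ultimately have "y \<noteq> 0" "x' = 0" by simp_all
    with True show ?thesis
      by (intro exI[of _ "y'"] exI[of _ "- y"] conjI) simp_all
  next
    case False
    moreover have "x' * x + - x * x' = 0" by simp
    moreover have "x' * y + - x * y' = 0" using * by simp
    ultimately show ?thesis
      by (intro exI[of _ "x'"] exI[of _ "- x"] conjI) simp_all
  qed
qed

definition col_slope :: "'a::field mat \<Rightarrow> nat \<Rightarrow> 'a option" where
  "col_slope G j = slope (G $$ (0, j)) (G $$ (1, j))"

lemma cols_dependent_gen_c_singleton:
  assumes "j < dim_col G"
  shows "cols_dependent (gen_c 2 G) {j} \<longleftrightarrow> G $$ (0, j) = 0 \<and> G $$ (1, j) = 0"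
proof -
  have "col (gen_c 2 G) j = 0\<^sub>v 2 \<longleftrightarrow> (\<forall>i<2. G $$ (i, j) = 0)"
    using assms by (auto simp: gen_c_def vec_eq_iff)
  then show ?thesis
    using assms cols_dependent_singleton[of j "gen_c 2 G"] by (auto simp: gen_c_def less_2_cases_iff)
qed

lemma cols_dependent_gen_c_pair:
  assumes "l \<noteq> m" "l < dim_col G" "m < dim_col G"
    and "\<not> cols_dependent (gen_c 2 G) {l}" "\<not> cols_dependent (gen_c 2 G) {m}"
  shows "cols_dependent (gen_c 2 G) {l, m} \<longleftrightarrow> col_slope G l = col_slope G m"
proof -
  have nz: "G $$ (0, l) \<noteq> 0 \<or> G $$ (1, l) \<noteq> 0" "G $$ (0, m) \<noteq> 0 \<or> G $$ (1, m) \<noteq> 0"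
    using assms cols_dependent_gen_c_singleton by blast+
  have "cols_dependent (gen_c 2 G) {l, m} \<longleftrightarrow> G $$ (0, l) * G $$ (1, m) = G $$ (0, m) * G $$ (1, l)"
    using assms(1-3) unfolding cols_dependent_pair[OF assms(1)] plane_vectors_dependent_iff[OF nz, symmetric]
    by (auto simp: gen_c_def less_2_cases_iff)
  then show ?thesis using slope_eq_iff[OF nz] by (simp add: col_slope_def)
qed

lemma cols_dependent_two_rows:
  assumes A: "A \<in> carrier_mat 2 n" and "l \<noteq> m" "l < n" "m < n"
    and "\<not> cols_dependent A {l}" "\<not> cols_dependent A {m}"
  shows "cols_dependent A {l, m} \<longleftrightarrow> col_slope A l = col_slope A m"
proof -
  have "gen_c 2 A = A" using A by (intro eq_matI) (auto simp: gen_c_def)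
  with cols_dependent_gen_c_pair[of l m A] assms show ?thesis by simp
qed

lemma cols_dependent_two_rows_det:
  assumes A: "A \<in> carrier_mat 2 n" and lm: "l \<noteq> m" "l < n" "m < n"
    and nz: "\<not> cols_dependent A {l}" "\<not> cols_dependent A {m}"
  shows "cols_dependent A {l, m} \<longleftrightarrow> A $$ (0, l) * A $$ (1, m) = A $$ (0, m) * A $$ (1, l)"
proof -
  have "gen_c 2 A = A" using A by (intro eq_matI) (auto simp: gen_c_def)
  then have "A $$ (0, l) \<noteq> 0 \<or> A $$ (1, l) \<noteq> 0" "A $$ (0, m) \<noteq> 0 \<or> A $$ (1, m) \<noteq> 0"
    using cols_dependent_gen_c_singleton[of l A] cols_dependent_gen_c_singleton[of m A] nz lm A by auto
  then show ?thesis
    using cols_dependent_two_rows[OF A lm nz] slope_eq_iff by (simp add: col_slope_def)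
qed

text \<open>
  The matrix becomes square by appending zero rows. A zero row makes the transpose kill a unit
  vector, so the determinant vanishes and the square matrix has a nonzero kernel vector.
\<close>

lemma cols_dependent_if_wide:
  fixes A :: "'a::field mat"
  assumes A: "A \<in> carrier_mat r n" and "r < n"
  shows "cols_dependent A {..<n}"
proof -
  \<comment> \<open>The row n - 1 of S is zero.\<close>
  define S where "S = mat n n (\<lambda>(i, j). if i < r then A $$ (i, j) else 0)"
  have S: "S \<in> carrier_mat n n" by (simp add: S_def)
  have "S\<^sup>T *\<^sub>v unit_vec n (n - 1) = 0\<^sub>v n"
    using \<open>r < n\<close> by (intro eq_vecI) (auto simp: S_def)
  moreover have "unit_vec n (n - 1) \<noteq> (0\<^sub>v n :: 'a vec)"
    using \<open>r < n\<close> unit_vec_nonzero[of n "n - 1"] by simp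
  ultimately have "det S\<^sup>T = 0"
    using det_0_iff_vec_prod_zero_field[of "S\<^sup>T" n] S unit_vec_carrier[of n "n - 1"]
      transpose_carrier_mat[of S] by blast
  then have "det S = 0" using det_transpose[OF S] by simp
  then obtain v where v: "v \<in> carrier_vec n" "v \<noteq> 0\<^sub>v n" "S *\<^sub>v v = 0\<^sub>v n"
    using det_0_iff_vec_prod_zero_field[OF S] by blast
  obtain j where "j < n" "v $ j \<noteq> 0" using v(1,2) by (auto simp: vec_eq_iff)
  moreover have "(\<Sum>j<n. v $ j * A $$ (i, j)) = 0" if "i < r" for i
  proof -
    have "(\<Sum>j<n. v $ j * A $$ (i, j)) = (S *\<^sub>v v) $ i"
      using that \<open>r < n\<close> v(1)
      by (auto simp: S_def scalar_prod_def atLeast0LessThan mult.commute intro!: sum.cong)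
    then show ?thesis using v(3) that \<open>r < n\<close> by simp
  qed
  ultimately show ?thesis using A unfolding cols_dependent_def
    by (intro exI[of _ "\<lambda>j. v $ j"]) auto
qed

section \<open>Confounding of effects\<close>

text \<open>
  In coding terms: the code with parity check matrix G has minimum distance greater than k.
\<close>

definition columns_independent_upto :: "nat \<Rightarrow> 'a::field mat \<Rightarrow> bool" where
  "columns_independent_upto k G \<longleftrightarrow>
     (\<forall>J \<subseteq> {..<dim_col G}. card J \<le> k \<longrightarrow> \<not> cols_dependent G J)"

text \<open>
  Two effects involve at most four factors, so independence of any four columns rules out
  confounding between effects and leaves only rows and columns of the array.
\<close>

lemma unconfounded_if_columns_independent:
  fixes G :: "'s::prime_card mod_ring mat"
  assumes "columns_independent_upto 4 G"
    and "E \<in> main_effects (dim_col G) \<union> two_factor_interactions (dim_col G)"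
  shows "unconfounded p G E \<longleftrightarrow>
    \<not> cols_dependent (gen_c p G) E \<and> \<not> cols_dependent (gen_r p G) E"
proof -
  have small: "F \<subseteq> {..<dim_col G} \<and> card F \<le> 2"
    if "F \<in> main_effects (dim_col G) \<union> two_factor_interactions (dim_col G)" for F
    using that by (auto simp: main_effects_def two_factor_interactions_eq)
  have "\<not> cols_dependent G (E \<union> E')"
    if "E' \<in> main_effects (dim_col G) \<union> two_factor_interactions (dim_col G)" for E'
  proof -
    have "card (E \<union> E') \<le> 4"
      using card_Un_le[of E E'] small[OF that] small[OF assms(2)] by linarith
    then show ?thesis
      using assms(1) small[OF that] small[OF assms(2)] by (auto simp: columns_independent_upto_def)
  qed
  then show ?thesis
    by (auto simp: unconfounded_def confounded_with_effect_def confounded_with_columns_def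
        confounded_with_rows_def)
qed

lemma main_effectsI: "j < n \<Longrightarrow> {j} \<in> main_effects n"
  by (auto simp: main_effects_def)

lemma main_effects_unconfoundedD:
  assumes "main_effects_unconfounded p G" "j < dim_col G"
  shows "\<not> cols_dependent (gen_c p G) {j}" "\<not> cols_dependent (gen_r p G) {j}"
proof -
  have "unconfounded p G {j}"
    using assms main_effectsI by (auto simp: main_effects_unconfounded_def)
  then show "\<not> cols_dependent (gen_c p G) {j}" "\<not> cols_dependent (gen_r p G) {j}"
    by (simp_all add: unconfounded_def confounded_with_columns_def confounded_with_rows_def)
qed

text \<open>
  This direction holds for every competitor: unconfounded main effects force the columns of
  \<open>gen_c\<close> to be nonzero, and then an interaction inside a fibre of \<open>col_slope\<close> is confounded
  with column effects.
\<close>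

lemma unconfounded_2fis_subset:
  fixes G :: "'s::prime_card mod_ring mat"
  assumes "main_effects_unconfounded 2 G"
  shows "{E \<in> two_factor_interactions (dim_col G). unconfounded 2 G E} \<subseteq>
    two_factor_interactions (dim_col G) - collisions (dim_col G) (col_slope G)"
proof
  fix E assume "E \<in> {E \<in> two_factor_interactions (dim_col G). unconfounded 2 G E}"
  then have E: "E \<in> two_factor_interactions (dim_col G)" and u: "unconfounded 2 G E" by auto
  obtain l m where lm: "E = {l, m}" "l < m" "m < dim_col G"
    using E by (rule two_factor_interactionsE)
  have "col_slope G l \<noteq> col_slope G m"
    using u lm cols_dependent_gen_c_pair[of l m G] main_effects_unconfoundedD[OF assms]
    by (auto simp: unconfounded_def confounded_with_columns_def)
  with E lm show "E \<in> two_factor_interactions (dim_col G) - collisions (dim_col G) (col_slope G)"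
    by (auto simp: collisions_def)
qed

lemma num_unconfounded_2fi_le:
  fixes G :: "'s::prime_card mod_ring mat"
  assumes "main_effects_unconfounded 2 G"
  shows "num_unconfounded_2fi 2 G \<le>
    card (two_factor_interactions (dim_col G)) - card (collisions (dim_col G) (col_slope G))"
proof -
  have "num_unconfounded_2fi 2 G \<le> card (two_factor_interactions (dim_col G) - collisions (dim_col G) (col_slope G))"
    unfolding num_unconfounded_2fi_def
    by (rule card_mono[OF _ unconfounded_2fis_subset[OF assms]]) simp
  then show ?thesis by (simp add: card_Diff_subset[OF finite_collisions collisions_subset])
qed

lemma main_effects_unconfoundedI:
  fixes G :: "'s::prime_card mod_ring mat"
  assumes ind: "columns_independent_upto 4 G" and "\<And>j. j < dim_col G \<Longrightarrow> \<not> cols_dependent (gen_c p G) {j}"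
    and "\<And>j. j < dim_col G \<Longrightarrow> \<not> cols_dependent (gen_r p G) {j}"
  shows "main_effects_unconfounded p G"
  unfolding main_effects_unconfounded_def
proof
  fix E assume "E \<in> main_effects (dim_col G)"
  then show "unconfounded p G E"
    using assms(2,3) unconfounded_if_columns_independent[OF ind, of E]
    by (auto simp: main_effects_def)
qed

text \<open>
  The hypotheses say that no effect is lost to other effects or to the rows of the array, so the
  interactions lost are exactly the collisions of \<open>col_slope\<close>. A competitor loses at least the
  collisions of its own slopes, and an even distribution has the fewest.
\<close>

lemma optimal_if_balanced:
  fixes G :: "'s::prime_card mod_ring mat"
  assumes gen: "array_generator 2 q n G"
    and ind: "columns_independent_upto 4 G"
    and c: "\<And>j. j < n \<Longrightarrow> \<not> cols_dependent (gen_c 2 G) {j}"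
    and r2: "\<And>l m. l < m \<Longrightarrow> m < n \<Longrightarrow> \<not> cols_dependent (gen_r 2 G) {l, m}"
    and bal: "\<And>t. card {j. j < n \<and> col_slope G j = t} \<in> {a, a + 1}"
  shows "yields_2fi_optimal 2 q n G"
proof -
  have n: "dim_col G = n" using gen by (auto simp: array_generator_def)
  have "2 \<le> n" using gen by (simp add: array_generator_def)
  have r1: "\<not> cols_dependent (gen_r 2 G) {j}" if "j < n" for j
    using independent_if_pair_independent[OF r2[of 0 j]]
      independent_if_pair_independent[OF r2[of j 1]] that \<open>2 \<le> n\<close> by (cases "j = 0") auto
  have main: "main_effects_unconfounded 2 G"
    using ind c r1 by (intro main_effects_unconfoundedI) (auto simp: n)
  have num: "card (two_factor_interactions n) - card (collisions n (col_slope G)) \<le> num_unconfounded_2fi 2 G"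
  proof -
    have "two_factor_interactions n - collisions n (col_slope G)
        \<subseteq> {E \<in> two_factor_interactions (dim_col G). unconfounded 2 G E}"
    proof
      fix E assume E: "E \<in> two_factor_interactions n - collisions n (col_slope G)"
      then obtain l m where lm: "E = {l, m}" "l < m" "m < n"
        by (auto elim: two_factor_interactionsE)
      have "col_slope G l \<noteq> col_slope G m"
        using E lm by (auto simp: collisions_def)
      then have "\<not> cols_dependent (gen_c 2 G) E"
        using lm cols_dependent_gen_c_pair[of l m G] c by (simp add: n)
      moreover have "\<not> cols_dependent (gen_r 2 G) E" using r2 lm by simp
      ultimately show "E \<in> {E \<in> two_factor_interactions (dim_col G). unconfounded 2 G E}"
        using E unconfounded_if_columns_independent[OF ind, of E] by (auto simp: n)
    qed
    then have "card (two_factor_interactions n - collisions n (col_slope G)) \<le> num_unconfounded_2fi 2 G"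
      unfolding num_unconfounded_2fi_def by (intro card_mono) auto
    then show ?thesis by (simp add: card_Diff_subset[OF finite_collisions collisions_subset])
  qed
  have "num_unconfounded_2fi 2 G' \<le> num_unconfounded_2fi 2 G"
    if "array_generator 2 q n G'" "main_effects_unconfounded 2 G'" for G' :: "'s mod_ring mat"
  proof -
    have n': "dim_col G' = n" using that(1) by (auto simp: array_generator_def)
    have "card (collisions n (col_slope G)) \<le> card (collisions n (col_slope G'))"
      using bal by (rule balanced_minimises_collisions)
    with num_unconfounded_2fi_le[OF that(2)] num show ?thesis by (simp add: n')
  qed
  with gen main show ?thesis by (simp add: yields_2fi_optimal_def)
qed

text \<open>
  Surjectivity of the map \<open>z \<mapsto> G z\<close> says that the columns span the whole space.
\<close>

lemma rank_eq_if_surjective: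
  fixes G :: "'a::field mat"
  assumes G: "G \<in> carrier_mat n m"
    and surj: "\<And>y. \<exists>z. \<forall>i<n. (\<Sum>j<m. z j * G $$ (i, j)) = y i"
  shows "vec_space.rank n G = n"
proof -
  interpret vec_space "TYPE('a)" n .
  have "\<exists>x\<in>carrier_vec (dim_col G). G *\<^sub>v x = y" if y: "y \<in> carrier_vec n" for y
  proof -
    obtain z where z: "\<forall>i<n. (\<Sum>j<m. z j * G $$ (i, j)) = y $ i"
      using surj[of "\<lambda>i. y $ i"] by blast
    have "G *\<^sub>v vec m z = y"
    proof (rule eq_vecI)
      fix i assume "i < dim_vec y"
      then show "(G *\<^sub>v vec m z) $ i = y $ i"
        using z G y by (auto simp: scalar_prod_def atLeast0LessThan mult.commute)
    qed (use G y in auto)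
    then show ?thesis using G by (intro bexI[of _ "vec m z"]) auto
  qed
  then have "span (set (cols G)) = carrier_vec n"
    using col_space_eq[OF G] G unfolding col_space_def by auto
  moreover have "vs (carrier_vec n) = V"
    by (simp add: module_vec_def)
  ultimately have "rank G = dim"
    unfolding rank_def by (simp only:)
  then show ?thesis by (simp only: dim_is_n)
qed

text \<open>
  A relation among at most k columns extends by zero to a kernel vector of weight at most k.
\<close>

lemma columns_independent_upto_if_weight:
  fixes G :: "'a::field mat"
  assumes "\<And>z j. \<forall>i<dim_row G. (\<Sum>j<dim_col G. z j * G $$ (i, j)) = 0 \<Longrightarrow>
      j < dim_col G \<Longrightarrow> z j \<noteq> 0 \<Longrightarrow>
      \<exists>S. finite S \<and> k < card S \<and> (\<forall>j\<in>S. z j \<noteq> 0)"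
  shows "columns_independent_upto k G"
  unfolding columns_independent_upto_def
proof (intro allI impI notI)
  fix J assume J: "J \<subseteq> {..<dim_col G}" "card J \<le> k" "cols_dependent G J"
  then obtain c j where c: "j \<in> J" "c j \<noteq> 0" "\<forall>i<dim_row G. (\<Sum>j\<in>J. c j * G $$ (i, j)) = 0"
    by (auto simp: cols_dependent_def)
  define z where "z j = (if j \<in> J then c j else 0)" for j
  have "(\<Sum>j<dim_col G. z j * G $$ (i, j)) = (\<Sum>j\<in>J. c j * G $$ (i, j))" for i
    unfolding z_def using J(1) by (intro sum.mono_neutral_cong_right) auto
  moreover have "j < dim_col G" using c J by auto
  moreover have "z j \<noteq> 0" using c by (simp add: z_def)
  ultimately obtain S where S: "finite S" "k < card S" "\<forall>j\<in>S. z j \<noteq> 0"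
    using assms[of z j] c(3) by auto
  have "S \<subseteq> J" using S(3) by (auto simp: z_def split: if_splits)
  then have "card S \<le> card J" using finite_subset[OF J(1)] by (intro card_mono) auto
  with S(2) J(2) show False by simp
qed

lemma five_nonzero:
  assumes "distinct [a, b, c, d, e]" "z a \<noteq> 0" "z b \<noteq> 0" "z c \<noteq> 0" "z d \<noteq> 0" "z e \<noteq> 0"
  shows "\<exists>S. finite S \<and> 4 < card S \<and> (\<forall>j\<in>S. z j \<noteq> 0)"
  using assms distinct_card[OF assms(1)] by (intro exI[of _ "set [a, b, c, d, e]"] conjI) auto

lemma gen_r_pair_independent_if_minor:
  fixes G :: "'a::field mat"
  assumes "l \<noteq> m" "l < dim_col G" "m < dim_col G"
    and "2 \<le> i" "i < dim_row G" "2 \<le> i'" "i' < dim_row G"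
    and minor: "G $$ (i, l) * G $$ (i', m) \<noteq> G $$ (i', l) * G $$ (i, m)"
  shows "\<not> cols_dependent (gen_r 2 G) {l, m}"
proof
  assume "cols_dependent (gen_r 2 G) {l, m}"
  then obtain a b where ab: "a \<noteq> 0 \<or> b \<noteq> 0"
      "\<forall>i<dim_row G - 2. a * G $$ (2 + i, l) + b * G $$ (2 + i, m) = 0"
    using assms(2,3) by (auto simp: cols_dependent_pair[OF assms(1)] gen_r_def)
  have row: "a * G $$ (i, l) + b * G $$ (i, m) = 0" if "2 \<le> i" "i < dim_row G" for i
    using ab(2)[rule_format, of "i - 2"] that by (simp only: le_add_diff_inverse diff_less_mono)
  define x x' y y' where "x = G $$ (i, l)" "x' = G $$ (i, m)" "y = G $$ (i', l)" "y' = G $$ (i', m)"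
  have e: "a * x + b * x' = 0" "a * y + b * y' = 0" "x * y' \<noteq> y * x'"
    using row assms unfolding x_x'_y_y'_def by auto
  have "x \<noteq> 0 \<or> y \<noteq> 0" "x' \<noteq> 0 \<or> y' \<noteq> 0" using e(3) by auto
  then have "x * y' = x' * y"
    using ab(1) e(1,2) plane_vectors_dependent_iff[of x y x' y'] by blast
  with e(3) show False by (simp add: mult.commute)
qed

section \<open>Arithmetic in small prime fields\<close>

lemma of_nat_mod_ring_eq_iff:
  assumes "a < CARD('s::prime_card)" "b < CARD('s)"
  shows "(of_nat a :: 's mod_ring) = of_nat b \<longleftrightarrow> a = b"
proof -
  have *: "x = y" if "x \<le> y" "y < CARD('s)" "(of_nat x :: 's mod_ring) = of_nat y" for x y
  proof -
    have "(of_nat (y - x) :: 's mod_ring) = 0" using that by (simp add: of_nat_diff)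
    then have "CARD('s) dvd y - x" by (rule of_nat_0_mod_ring_dvd)
    with that(1,2) show "x = y" by (auto dest: dvd_imp_le)
  qed
  show ?thesis
    using *[of a b] *[of b a] assms by (metis nle_le)
qed

text \<open>
  These conditional rules let the simplifier decide equations between numerals once a lower
  bound on the characteristic is known.
\<close>

lemma numeral_mod_ring_eq:
  "numeral k < CARD('s) \<Longrightarrow> numeral l < CARD('s) \<Longrightarrow>
     (numeral k :: 's::prime_card mod_ring) = numeral l \<longleftrightarrow> k = l"
  using of_nat_mod_ring_eq_iff[where 's='s, of "numeral k" "numeral l"] by simp

lemma numeral_mod_ring_neq_zero:
  "numeral k < CARD('s) \<Longrightarrow> (numeral k :: 's::prime_card mod_ring) \<noteq> 0"
  using of_nat_mod_ring_eq_iff[where 's='s, of "numeral k" 0] by simp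

lemma numeral_mod_ring_eq_one:
  "numeral k < CARD('s) \<Longrightarrow> (numeral k :: 's::prime_card mod_ring) = 1 \<longleftrightarrow> k = num.One"
  using numeral_mod_ring_eq[where 's='s, of k num.One] prime_card[where 'a='s]
  by (simp add: prime_gt_1_nat del: One_nat_def)

lemma of_nat_CARD_diff:
  "k \<le> CARD('s) \<Longrightarrow> (of_nat (CARD('s) - k) :: 's::prime_card mod_ring) = - of_nat k"
  by (simp add: of_nat_diff)

text \<open>
  The points 0, 1, 2, -1, -2, -3 and infinity, which occur in the generators, are pairwise
  distinct as soon as the characteristic is at least 7; 3 and 5 need their own computation.
\<close>

lemma odd_CARD_cases:
  assumes "odd (CARD('s::prime_card))"
  shows "CARD('s) = 3 \<or> CARD('s) = 5 \<or> 7 \<le> CARD('s)"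
proof -
  have "prime (CARD('s))" by (rule prime_card)
  then have "CARD('s) \<ge> 2" by (rule prime_ge_2_nat)
  moreover have "CARD('s) \<noteq> 2" "CARD('s) \<noteq> 4" "CARD('s) \<noteq> 6" using assms by auto
  ultimately show ?thesis by linarith
qed

lemma two_neq_zero_mod_ring:
  assumes "odd (CARD('s::prime_card))"
  shows "(2 :: 's mod_ring) \<noteq> 0"
  using odd_CARD_cases[OF assms] by (intro numeral_mod_ring_neq_zero) auto

text \<open>
  Slopes such as -1 and -2 have to be compared with 1 and 2; over GF(3) they are brought to the
  normal form 0, 1, 2 for this.
\<close>

lemma GF3_facts:
  assumes "CARD('s::prime_card) = 3"
  shows "(x :: 's mod_ring) \<in> {0, 1, 2}" "(-2 :: 's mod_ring) = 1" "(-1 :: 's mod_ring) = 2"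
    "(2 :: 's mod_ring) \<noteq> 0" "(2 :: 's mod_ring) \<noteq> 1" "(3 :: 's mod_ring) = 0"
proof -
  obtain i where "i < 3" "x = of_nat i"
    using surj_of_nat_mod_ring[of x] assms by auto
  then show "x \<in> {0, 1, 2}" by (auto simp: less_Suc_eq eval_nat_numeral)
  have "(of_nat 3 :: 's mod_ring) = 0"
    using of_nat_card_eq_0[where 'a='s] by (simp only: assms)
  then show 3: "(3 :: 's mod_ring) = 0" by simp
  show "(-2 :: 's mod_ring) = 1" "(-1 :: 's mod_ring) = 2"
    by (rule minus_unique, simp add: 3)+
  show "(2 :: 's mod_ring) \<noteq> 0" "(2 :: 's mod_ring) \<noteq> 1"
    using assms by (simp_all add: numeral_mod_ring_neq_zero numeral_mod_ring_eq_one)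
qed

lemma GF5_facts:
  assumes "CARD('s::prime_card) = 5"
  shows "(x :: 's mod_ring) \<in> {0, 1, 2, 3, 4}"
    "(-3 :: 's mod_ring) = 2" "(-2 :: 's mod_ring) = 3" "(-1 :: 's mod_ring) = 4"
proof -
  obtain i where "i < 5" "x = of_nat i"
    using surj_of_nat_mod_ring[of x] assms by auto
  then show "x \<in> {0, 1, 2, 3, 4}" by (auto simp: less_Suc_eq eval_nat_numeral)
  have "(of_nat 5 :: 's mod_ring) = 0"
    using of_nat_card_eq_0[where 'a='s] by (simp only: assms)
  then have 5: "(5 :: 's mod_ring) = 0" by simp
  show "(-3 :: 's mod_ring) = 2" "(-2 :: 's mod_ring) = 3" "(-1 :: 's mod_ring) = 4"
    by (rule minus_unique, simp add: 5)+
qed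

lemma one_eq_numeral_mod_ring:
  "numeral k < CARD('s) \<Longrightarrow> 1 = (numeral k :: 's::prime_card mod_ring) \<longleftrightarrow> k = num.One"
  "numeral k < CARD('s) \<Longrightarrow> 0 \<noteq> (numeral k :: 's::prime_card mod_ring)"
  using numeral_mod_ring_eq_one[where 's='s, of k] numeral_mod_ring_neq_zero[where 's='s, of k]
  by (simp_all only: eq_commute[of 1 "numeral k"] eq_commute[of 0 "numeral k"]) simp_all

lemma GF3_nonzero_cases:
  "CARD('s::prime_card) = 3 \<Longrightarrow> x \<noteq> 0 \<Longrightarrow> (x :: 's mod_ring) = 1 \<or> x = -1"
  using GF3_facts(1)[where 's='s, of x] GF3_facts(3)[where 's='s] by auto

lemma GF3_sum_three_nonzero:
  fixes d e f :: "'s::prime_card mod_ring"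
  assumes s: "CARD('s) = 3" and nz: "d \<noteq> 0" "e \<noteq> 0" "f \<noteq> 0" and sum: "d + e + f = 0"
  shows "e = d" "f = d"
proof -
  have "(1 :: 's mod_ring) \<noteq> 0" by simp
  then show "e = d" "f = d"
    using GF3_nonzero_cases[OF s nz(1)] GF3_nonzero_cases[OF s nz(2)] GF3_nonzero_cases[OF s nz(3)] sum
    by (elim disjE; simp)+
qed

lemma GF3_distinct_nonzero:
  fixes d e :: "'s::prime_card mod_ring"
  assumes s: "CARD('s) = 3" and nz: "d \<noteq> 0" "e \<noteq> 0" "d \<noteq> e"
  shows "d + e = 0"
  using GF3_nonzero_cases[OF s nz(1)] GF3_nonzero_cases[OF s nz(2)] nz(3) by auto

section \<open>Generators in block form\<close>

lemma append_cols_carrier [simp]: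
  "A \<in> carrier_mat r c \<Longrightarrow> B \<in> carrier_mat r c' \<Longrightarrow> A @\<^sub>c B \<in> carrier_mat r (c + c')"
  by (auto simp: append_cols_def)

lemma append_cols_dim [simp]:
  "dim_row (A @\<^sub>c B) = dim_row A" "dim_col (A @\<^sub>c B) = dim_col A + dim_col B"
  by (auto simp: append_cols_def)

lemma append_cols_index:
  assumes "i < dim_row A" "dim_row B = dim_row A" "j < dim_col A + dim_col B"
  shows "(A @\<^sub>c B) $$ (i, j) = (if j < dim_col A then A $$ (i, j) else B $$ (i, j - dim_col A))"
proof -
  have "(A @\<^sub>c B) $$ (i, j) =
      (if j < dim_col A then A $$ (i, j) else B $$ (i, j - dim_col A))"
    using assms unfolding append_cols_def four_block_mat_def Let_def by simp
  then show ?thesis .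
qed

lemma append_rows_dim [simp]:
  "dim_row (A @\<^sub>r B) = dim_row A + dim_row B" "dim_col (A @\<^sub>r B) = dim_col A"
  by (auto simp: append_rows_def)

lemma append_rows_index:
  assumes "i < dim_row A + dim_row B" "dim_col B = dim_col A" "j < dim_col A"
  shows "(A @\<^sub>r B) $$ (i, j) = (if i < dim_row A then A $$ (i, j) else B $$ (i - dim_row A, j))"
  using assms unfolding append_rows_def by simp

text \<open>
  The common shape of all four generators. Adding the identity to M in the lower half means that
  subtracting a row of the upper half from the corresponding row of the lower half isolates one
  coordinate of a kernel vector.
\<close>

definition stacked_generator :: "'a::field mat \<Rightarrow> 'a mat \<Rightarrow> 'a mat \<Rightarrow> 'a mat \<Rightarrow> 'a mat" where
  "stacked_generator M A B C =
     (1\<^sub>m 2 @\<^sub>c M @\<^sub>c A) @\<^sub>r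
     (1\<^sub>m 2 @\<^sub>c (M + 1\<^sub>m 2) @\<^sub>c B) @\<^sub>r
     (0\<^sub>m (dim_row C) 2 @\<^sub>c 0\<^sub>m (dim_row C) 2 @\<^sub>c C)"

text \<open>
  Here \<open>k = q - 2\<close> is the number of rows below the two copies of \<open>I\<close>, so the matrix has k + 4
  rows and k + 5 columns, and the blocks A, B, C occupy the columns with indices from 4 on.
\<close>

locale stacked =
  fixes k :: nat and M A B C :: "'a::field mat"
  assumes M: "M \<in> carrier_mat 2 2" and A: "A \<in> carrier_mat 2 (k + 1)"
    and B: "B \<in> carrier_mat 2 (k + 1)" and C: "C \<in> carrier_mat k (k + 1)"
begin

abbreviation "G \<equiv> stacked_generator M A B C"

lemma carrier: "G \<in> carrier_mat (k + 4) (k + 5)"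
  using M A B C by (auto simp: stacked_generator_def)

lemma dims [simp]: "dim_row G = k + 4" "dim_col G = k + 5"
  using carrier by auto

lemma entry_head:
  assumes "i < k + 4" "j < 2"
  shows "G $$ (i, j) = (if i = j \<or> i = j + 2 then 1 else 0)"
  using assms M A B C
  by (auto simp: stacked_generator_def append_rows_index append_cols_index)

lemma entry_middle:
  assumes "i < k + 4" "j < 2"
  shows "G $$ (i, 2 + j) = (if i < 2 then M $$ (i, j)
     else if i < 4 then M $$ (i - 2, j) + (if i = j + 2 then 1 else 0) else 0)"
  using assms M A B C
  by (auto simp: stacked_generator_def append_rows_index append_cols_index)

lemma entry_tail:
  assumes "i < k + 4" "j < k + 1"
  shows "G $$ (i, 4 + j) = (if i < 2 then A $$ (i, j)
     else if i < 4 then B $$ (i - 2, j) else C $$ (i - 4, j))"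
  using assms M A B C
  by (auto simp: stacked_generator_def append_rows_index append_cols_index)

lemma row_sum:
  "(\<Sum>j<k + 5. z j * G $$ (i, j)) = z 0 * G $$ (i, 0) + z 1 * G $$ (i, 1)
     + z 2 * G $$ (i, 2) + z 3 * G $$ (i, 3) + (\<Sum>j<k + 1. z (4 + j) * G $$ (i, 4 + j))"
proof -
  have "(\<Sum>j<k + 5. z j * G $$ (i, j)) = (\<Sum>j<Suc (Suc (Suc (Suc (k + 1)))). z j * G $$ (i, j))"
    by (simp add: eval_nat_numeral)
  also have "\<dots> = z 0 * G $$ (i, 0) + z 1 * G $$ (i, 1)
     + z 2 * G $$ (i, 2) + z 3 * G $$ (i, 3) + (\<Sum>j<k + 1. z (4 + j) * G $$ (i, 4 + j))"
    unfolding sum.lessThan_Suc_shift[of _ "Suc _"] sum.lessThan_Suc_shift[of _ "k + 1"]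
    by (simp add: eval_nat_numeral add.assoc)
  finally show ?thesis .
qed

lemma row_sum_c:
  assumes "i < 2"
  shows "(\<Sum>j<k + 5. z j * G $$ (i, j)) =
    z i + z 2 * M $$ (i, 0) + z 3 * M $$ (i, 1) + (\<Sum>j<k + 1. z (4 + j) * A $$ (i, j))"
proof -
  have "(\<Sum>j<k + 1. z (4 + j) * G $$ (i, 4 + j)) = (\<Sum>j<k + 1. z (4 + j) * A $$ (i, j))"
    using assms by (intro sum.cong) (auto simp: entry_tail)
  then show ?thesis
    unfolding row_sum using assms entry_middle[of i 0] entry_middle[of i 1]
    by (auto simp: entry_head less_2_cases_iff)
qed

lemma row_sum_r:
  assumes "i < 2"
  shows "(\<Sum>j<k + 5. z j * G $$ (2 + i, j)) =
    z i + z 2 * M $$ (i, 0) + z 3 * M $$ (i, 1) + z (2 + i) + (\<Sum>j<k + 1. z (4 + j) * B $$ (i, j))"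
proof -
  have "(\<Sum>j<k + 1. z (4 + j) * G $$ (2 + i, 4 + j)) = (\<Sum>j<k + 1. z (4 + j) * B $$ (i, j))"
    using assms by (intro sum.cong) (auto simp: entry_tail)
  moreover have "z 0 * G $$ (2 + i, 0) + z 1 * G $$ (2 + i, 1) = z i"
    using assms by (auto simp: entry_head less_2_cases_iff)
  moreover have "z 2 * G $$ (2 + i, 2) + z 3 * G $$ (2 + i, 3) =
      z 2 * M $$ (i, 0) + z 3 * M $$ (i, 1) + z (2 + i)"
    using less_2_cases[OF assms] entry_middle[of "2 + i" 0] entry_middle[of "2 + i" 1]
    by (elim disjE) (simp_all add: distrib_left)
  ultimately show ?thesis
    unfolding row_sum by (simp only: add_ac)
qed

lemma row_sum_bottom:
  assumes "i < k"
  shows "(\<Sum>j<k + 5. z j * G $$ (4 + i, j)) = (\<Sum>j<k + 1. z (4 + j) * C $$ (i, j))"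
proof -
  have "(\<Sum>j<k + 1. z (4 + j) * G $$ (4 + i, 4 + j)) = (\<Sum>j<k + 1. z (4 + j) * C $$ (i, j))"
    using assms by (intro sum.cong) (auto simp: entry_tail)
  then show ?thesis
    unfolding row_sum using assms entry_middle[of "4 + i" 0] entry_middle[of "4 + i" 1]
    by (auto simp: entry_head)
qed

text \<open>
  A kernel vector is determined by its entries from index 4 on, which form a kernel vector of C:
  the difference of the upper and lower rows gives the entries 2 and 3, and the upper rows then
  give the entries 0 and 1.
\<close>

lemma kernel:
  assumes "\<forall>i<k + 4. (\<Sum>j<k + 5. z j * G $$ (i, j)) = 0"
  shows "i < k \<Longrightarrow> (\<Sum>j<k + 1. z (4 + j) * C $$ (i, j)) = 0"
    and "i < 2 \<Longrightarrow> z (2 + i) = (\<Sum>j<k + 1. z (4 + j) * (A $$ (i, j) - B $$ (i, j)))"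
    and "i < 2 \<Longrightarrow> z i = - (z 2 * M $$ (i, 0) + z 3 * M $$ (i, 1) + (\<Sum>j<k + 1. z (4 + j) * A $$ (i, j)))"
proof -
  show "(\<Sum>j<k + 1. z (4 + j) * C $$ (i, j)) = 0" if "i < k"
    using assms[rule_format, of "4 + i"] that unfolding row_sum_bottom[OF that] by simp
next
  assume i: "i < 2"
  have c: "z i + z 2 * M $$ (i, 0) + z 3 * M $$ (i, 1) + (\<Sum>j<k + 1. z (4 + j) * A $$ (i, j)) = 0"
    using assms[rule_format, of i] i unfolding row_sum_c[OF i] by simp
  have r: "z i + z 2 * M $$ (i, 0) + z 3 * M $$ (i, 1) + z (2 + i) + (\<Sum>j<k + 1. z (4 + j) * B $$ (i, j)) = 0"
    using assms[rule_format, of "2 + i"] i unfolding row_sum_r[OF i] by simp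
  have "(\<Sum>j<k + 1. z (4 + j) * (A $$ (i, j) - B $$ (i, j))) =
      (\<Sum>j<k + 1. z (4 + j) * A $$ (i, j)) - (\<Sum>j<k + 1. z (4 + j) * B $$ (i, j))"
    by (simp add: right_diff_distrib sum_subtractf)
  also have "\<dots> = z (2 + i)"
    using c[unfolded add_eq_0_iff] r[unfolded add_eq_0_iff] by simp
  finally show "z (2 + i) = (\<Sum>j<k + 1. z (4 + j) * (A $$ (i, j) - B $$ (i, j)))" ..
  show "z i = - (z 2 * M $$ (i, 0) + z 3 * M $$ (i, 1) + (\<Sum>j<k + 1. z (4 + j) * A $$ (i, j)))"
    using c by (simp only: eq_neg_iff_add_eq_0 add.assoc)
qed

text \<open>
  The system is solved in the same order: first the tail by surjectivity of C, then the entries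
  2 and 3 (the vector u below) from the difference of the upper and lower rows, and last the
  entries 0 and 1.
\<close>

lemma rank:
  assumes "\<And>y. \<exists>x. \<forall>i<k. (\<Sum>j<k + 1. x j * C $$ (i, j)) = y i"
  shows "vec_space.rank (k + 4) G = k + 4"
proof (rule rank_eq_if_surjective[OF carrier])
  fix y :: "nat \<Rightarrow> 'a"
  obtain x where x: "\<forall>i<k. (\<Sum>j<k + 1. x j * C $$ (i, j)) = y (4 + i)"
    using assms[of "\<lambda>i. y (4 + i)"] by blast
  define u where "u i = y (2 + i) - y i
      + (\<Sum>j<k + 1. x j * A $$ (i, j)) - (\<Sum>j<k + 1. x j * B $$ (i, j))" for i
  define z where "z j = (if j < 2 then y j - u 0 * M $$ (j, 0) - u 1 * M $$ (j, 1)
        - (\<Sum>l<k + 1. x l * A $$ (j, l))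
      else if j < 4 then u (j - 2) else x (j - 4))" for j
  have z: "z 2 = u 0" "z 3 = u 1" "\<And>j. z (4 + j) = x j" by (simp_all add: z_def)
  have "(\<Sum>j<k + 5. z j * G $$ (i, j)) = y i" if i: "i < k + 4" for i
  proof -
    consider "i < 2" | i' where "i = 2 + i'" "i' < 2" | i' where "i = 4 + i'" "i' < k"
    proof -
      have "i < 2 \<or> i = 2 + (i - 2) \<and> i - 2 < 2 \<or> i = 4 + (i - 4) \<and> i - 4 < k" using i by linarith
      then show thesis using that by blast
    qed
    then show ?thesis
    proof cases
      case 1
      then show ?thesis unfolding row_sum_c[OF 1] z by (simp add: z_def)
    next
      case 2
      then show ?thesis unfolding 2 row_sum_r[OF 2(2)] z by (simp add: z_def u_def)
    next
      case 3
      then show ?thesis unfolding 3 row_sum_bottom[OF 3(2)] z using x by simp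
    qed
  qed
  then show "\<exists>z. \<forall>i<k + 4. (\<Sum>j<k + 5. z j * G $$ (i, j)) = y i" by blast
qed

lemma col_slopes:
  assumes "M $$ (0, 0) = 1" "M $$ (0, 1) = 1"
  shows "col_slope G 0 = Some 0" "col_slope G 1 = None"
    "col_slope G 2 = Some (M $$ (1, 0))" "col_slope G 3 = Some (M $$ (1, 1))"
    "j < k + 1 \<Longrightarrow> col_slope G (4 + j) = slope (A $$ (0, j)) (A $$ (1, j))"
  using assms entry_middle[of _ 0] entry_middle[of _ 1]
  by (simp_all add: col_slope_def entry_head entry_tail slope_def)

lemma cases_column:
  assumes "j < k + 5"
  obtains "j < 2" | j' where "j = 2 + j'" "j' < 2" | j' where "j = 4 + j'" "j' < k + 1"
proof -
  have "j < 2 \<or> j = 2 + (j - 2) \<and> j - 2 < 2 \<or> j = 4 + (j - 4) \<and> j - 4 < k + 1" using assms by linarith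
  then show thesis using that by blast
qed

lemma gen_c_columns_nonzero:
  assumes "M $$ (0, 0) = 1" "M $$ (0, 1) = 1"
    and "\<And>j. j < k + 1 \<Longrightarrow> A $$ (0, j) \<noteq> 0 \<or> A $$ (1, j) \<noteq> 0"
    and "j < k + 5"
  shows "\<not> cols_dependent (gen_c 2 G) {j}"
  using assms(4)
proof (cases rule: cases_column)
  case 1
  then show ?thesis using assms(4) by (auto simp: cols_dependent_gen_c_singleton entry_head less_2_cases_iff)
next
  case (2 j')
  then show ?thesis using assms(1,2,4)
    by (auto simp: cols_dependent_gen_c_singleton entry_middle less_2_cases_iff simp del: add_2_eq_Suc)
next
  case (3 j')
  then show ?thesis using assms(3)[of j'] assms(4)
    by (simp add: cols_dependent_gen_c_singleton entry_tail)
qed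

text \<open>
  Among the first four columns, the two rows containing the identity and \<open>M + I\<close> already provide
  a nonzero minor. One of the first four columns and a later one are separated by C, in which
  the first four columns vanish. Two later columns are separated by C alone, or by a row of B
  together with a row of C; the second alternative is the one available when C has a single row.
\<close>

lemma gen_r_pair_independent:
  assumes N: "M $$ (0, 0) + 1 \<noteq> 0" "M $$ (0, 1) \<noteq> 0" "M $$ (1, 0) \<noteq> 0" "M $$ (1, 1) + 1 \<noteq> 0"
      "(M $$ (0, 0) + 1) * (M $$ (1, 1) + 1) \<noteq> M $$ (1, 0) * M $$ (0, 1)"
    and C1: "\<And>j. j < k + 1 \<Longrightarrow> \<exists>i<k. C $$ (i, j) \<noteq> 0"
    and C2: "\<And>j j'. j < j' \<Longrightarrow> j' < k + 1 \<Longrightarrow>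
      (\<exists>i<2. \<exists>i'<k. B $$ (i, j) * C $$ (i', j') \<noteq> C $$ (i', j) * B $$ (i, j')) \<or>
      (\<exists>i<k. \<exists>i'<k. C $$ (i, j) * C $$ (i', j') \<noteq> C $$ (i', j) * C $$ (i, j'))"
    and lm: "l < m" "m < k + 5"
  shows "\<not> cols_dependent (gen_r 2 G) {l, m}"
proof -
  have minor: ?thesis if "2 \<le> i" "i < k + 4" "2 \<le> i'" "i' < k + 4"
    "G $$ (i, l) * G $$ (i', m) \<noteq> G $$ (i', l) * G $$ (i, m)" for i i'
    by (rule gen_r_pair_independent_if_minor[where i=i and i'=i']) (use lm that in auto)
  have e: "G $$ (2, 0) = 1" "G $$ (3, 0) = 0" "G $$ (2, 1) = 0" "G $$ (3, 1) = 1"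
    "G $$ (2, 2) = M $$ (0, 0) + 1" "G $$ (3, 2) = M $$ (1, 0)"
    "G $$ (2, 3) = M $$ (0, 1)" "G $$ (3, 3) = M $$ (1, 1) + 1"
    using entry_middle[of _ 0] entry_middle[of _ 1] by (simp_all add: entry_head)
  consider "m < 4" | m' where "l < 4" "m = 4 + m'" "m' < k + 1"
    | l' m' where "l = 4 + l'" "m = 4 + m'" "l' < m'" "m' < k + 1"
  proof -
    have "m < 4 \<or> l < 4 \<and> m = 4 + (m - 4) \<and> m - 4 < k + 1 \<or>
        l = 4 + (l - 4) \<and> m = 4 + (m - 4) \<and> l - 4 < m - 4 \<and> m - 4 < k + 1"
      using lm by linarith
    then show thesis using that by blast
  qed
  then show ?thesis
  proof cases
    case 1
    then have "l = 0 \<and> m = 1 \<or> l = 0 \<and> m = 2 \<or> l = 0 \<and> m = 3 \<or> l = 1 \<and> m = 2 \<or> l = 1 \<and> m = 3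
        \<or> l = 2 \<and> m = 3" using lm by linarith
    then have "G $$ (2, l) * G $$ (3, m) \<noteq> G $$ (3, l) * G $$ (2, m)"
      using N e by (elim disjE conjE) simp_all
    then show ?thesis using minor[of 2 3] by simp
  next
    case 2
    then have "l = 0 \<or> l = 1 \<or> l = 2 \<or> l = 3" by linarith
    then have "\<exists>i'\<in>{2, 3}. G $$ (i', l) \<noteq> 0"
      using N e by (elim disjE) simp_all
    then obtain i' where i': "i' \<in> {2, 3}" "G $$ (i', l) \<noteq> 0" by blast
    obtain i where i: "i < k" "C $$ (i, m') \<noteq> 0" using C1 2 by blast
    have "G $$ (4 + i, l) = 0"
      using \<open>l = 0 \<or> l = 1 \<or> l = 2 \<or> l = 3\<close> i entry_middle[of "4 + i" 0] entry_middle[of "4 + i" 1]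
      by (elim disjE) (simp_all add: entry_head)
    moreover have "G $$ (4 + i, m) = C $$ (i, m')"
      using i 2 by (simp only: entry_tail) simp
    ultimately show ?thesis using i i' minor[of "4 + i" i'] by auto
  next
    case 3
    have c: "G $$ (4 + i, 4 + j) = C $$ (i, j)" if "i < k" "j < k + 1" for i j
      using that by (simp only: entry_tail) simp
    have b: "G $$ (2 + i, 4 + j) = B $$ (i, j)" if "i < 2" "j < k + 1" for i j
      using that by (simp only: entry_tail) simp
    show ?thesis
      using C2[OF 3(3,4)]
    proof (elim disjE exE conjE)
      fix i i' assume i: "i < 2" "i' < k" "B $$ (i, l') * C $$ (i', m') \<noteq> C $$ (i', l') * B $$ (i, m')"
      show ?thesis
        by (rule minor[of "2 + i" "4 + i'"]) (use i 3 b c in simp_all)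
    next
      fix i i' assume i: "i < k" "i' < k" "C $$ (i, l') * C $$ (i', m') \<noteq> C $$ (i', l') * C $$ (i, m')"
      show ?thesis
        by (rule minor[of "4 + i" "4 + i'"]) (use i 3 c in simp_all)
    qed
  qed
qed

lemma kernel_tail_nonzero:
  assumes "\<forall>i<k + 4. (\<Sum>j<k + 5. z j * G $$ (i, j)) = 0" "j < k + 5" "z j \<noteq> 0"
  obtains j' where "j' < k + 1" "z (4 + j') \<noteq> 0"
proof -
  have False if t: "\<And>j. j < k + 1 \<Longrightarrow> z (4 + j) = 0"
  proof -
    have s: "(\<Sum>j<k + 1. z (4 + j) * f j) = 0" for f using t by (intro sum.neutral) simp
    have z2: "z (2 + i) = 0" if "i < 2" for i
      using kernel(2)[OF assms(1) that] unfolding s .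
    have "z 2 = 0" "z 3 = 0" using z2[of 0] z2[of 1] by simp_all
    then have z0: "z i = 0" if "i < 2" for i
      using kernel(3)[OF assms(1) that] unfolding s by (simp add: \<open>z 2 = 0\<close> \<open>z 3 = 0\<close>)
    from assms(2) show False
      by (cases rule: cases_column) (use assms(3) z0 z2 t in auto)
  qed
  with that show thesis by blast
qed

end

section \<open>The generators for q \<ge> 3\<close>

lemma M0_carrier [simp]: "M0 \<in> carrier_mat 2 2" "dim_row M0 = 2" "dim_col M0 = 2"
  by (auto simp: M0_def mat_of_rows_list_def)

lemma M0_index [simp]:
  "M0 $$ (0, 0) = 1" "M0 $$ (0, Suc 0) = 1" "M0 $$ (Suc 0, 0) = 2" "M0 $$ (Suc 0, Suc 0) = 1"
  by (simp_all add: M0_def mat_of_rows_list_def)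

lemma single_column [simp]:
  "i < r \<Longrightarrow> mat_of_cols_list r [xs] $$ (i, 0) = xs ! i"
  "dim_row (mat_of_cols_list r [xs]) = r" "dim_col (mat_of_cols_list r [xs]) = 1"
  by (simp_all add: mat_of_cols_list_def)

text \<open>
  For \<open>M = M0\<close> the block \<open>M + I\<close> has the entries 2, 1, 2, 2 and determinant 2, so that the
  conditions on M hold in odd characteristic.
\<close>

lemma stacked_M0_optimal:
  fixes A B C :: "'s::prime_card mod_ring mat"
  assumes odd: "odd (CARD('s))" and st: "stacked k M0 A B C"
    and surj: "\<And>y. \<exists>x. \<forall>i<k. (\<Sum>j<k + 1. x j * C $$ (i, j)) = y i"
    and A1: "\<And>j. j < k + 1 \<Longrightarrow> A $$ (0, j) \<noteq> 0 \<or> A $$ (1, j) \<noteq> 0"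
    and C1: "\<And>j. j < k + 1 \<Longrightarrow> \<exists>i<k. C $$ (i, j) \<noteq> 0"
    and C2: "\<And>j j'. j < j' \<Longrightarrow> j' < k + 1 \<Longrightarrow>
      (\<exists>i<2. \<exists>i'<k. B $$ (i, j) * C $$ (i', j') \<noteq> C $$ (i', j) * B $$ (i, j')) \<or>
      (\<exists>i<k. \<exists>i'<k. C $$ (i, j) * C $$ (i', j') \<noteq> C $$ (i', j) * C $$ (i, j'))"
    and ind: "columns_independent_upto 4 (stacked_generator M0 A B C)"
    and bal: "\<And>t. card {j. j < k + 5 \<and> col_slope (stacked_generator M0 A B C) j = t} \<in> {a, a + 1}"
  shows "yields_2fi_optimal 2 (k + 2) (k + 5) (stacked_generator M0 A B C)"
proof -
  interpret stacked k M0 A B C by (rule st)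
  note two = two_neq_zero_mod_ring[OF odd]
  have "(4 :: 's mod_ring) \<noteq> 2"
  proof
    assume "(4 :: 's mod_ring) = 2"
    then have "(2 :: 's mod_ring) + 2 = 2" by simp
    with two show False by (simp only: add_cancel_left_left)
  qed
  note two = two this
  have r: "\<not> cols_dependent (gen_r 2 G) {l, m}" if "l < m" "m < k + 5" for l m
    by (rule gen_r_pair_independent[OF _ _ _ _ _ C1 C2 that]) (use two in auto)
  show ?thesis
  proof (rule optimal_if_balanced[OF _ ind _ r bal])
    show "array_generator 2 (k + 2) (k + 5) G"
      using rank[OF surj] carrier by (simp add: array_generator_def add.commute[of _ k] del: add_2_eq_Suc')
    show "\<not> cols_dependent (gen_c 2 G) {j}" if "j < k + 5" for j
      by (rule gen_c_columns_nonzero[OF _ _ A1 that]) auto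
  qed
qed

lemma G_q3_stacked:
  "(G_q3 :: 's::prime_card mod_ring mat) = stacked_generator M0
     (column [1, of_nat (CARD('s) - 2)] @\<^sub>c column [1, of_nat (CARD('s) - 1)])
     (column [1, 0] @\<^sub>c 0\<^sub>m 2 1) (column [1] @\<^sub>c column [1])"
  by (simp add: G_q3_def stacked_generator_def Let_def)

text \<open>
  The kernel is spanned by (2, 4, -1, -1, 1, -1). The upper half has the slopes 0, infinity, 2,
  1, -2, -1. They are pairwise distinct for s at least 5; over GF(3) they cover each of the four
  points once or twice.
\<close>

lemma G_q3_optimal:
  assumes odd: "odd (CARD('s::prime_card))"
  shows "yields_2fi_optimal 2 3 6 (G_q3 :: 's mod_ring mat)"
proof -
  define A B C :: "'s mod_ring mat" where "A = column [1, of_nat (CARD('s) - 2)] @\<^sub>c column [1, of_nat (CARD('s) - 1)]"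
    and "B = column [1, 0] @\<^sub>c 0\<^sub>m 2 1" and "C = column [1] @\<^sub>c column [1]"
  have st: "stacked 1 M0 A B C"
    by (auto simp: stacked_def A_def B_def C_def append_cols_def mat_of_cols_list_def)
  interpret stacked 1 M0 A B C by (rule st)
  note two = two_neq_zero_mod_ring[OF odd]
  have card3: "3 \<le> CARD('s)" using odd_CARD_cases[OF odd] by auto
  have A: "A $$ (0, 0) = 1" "A $$ (0, Suc 0) = 1" "A $$ (Suc 0, 0) = -2" "A $$ (Suc 0, Suc 0) = -1"
    using card3 by (simp_all add: A_def append_cols_index of_nat_CARD_diff del: One_nat_def) 
  have B: "B $$ (0, 0) = 1" "B $$ (0, Suc 0) = 0" "B $$ (Suc 0, 0) = 0" "B $$ (Suc 0, Suc 0) = 0"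
    by (simp_all add: B_def append_cols_index)
  have C: "C $$ (0, 0) = 1" "C $$ (0, Suc 0) = 1"
    by (simp_all add: C_def append_cols_index)
  have ind: "columns_independent_upto 4 G"
  proof (rule columns_independent_upto_if_weight)
    fix z j assume k: "\<forall>i<dim_row G. (\<Sum>j<dim_col G. z j * G $$ (i, j)) = 0" and j: "j < dim_col G" "z j \<noteq> 0"
    note K = kernel[OF k[unfolded dims]]
    have "z 4 + z 5 = 0" using K(1)[of 0] by (simp add: C)
    then have 5: "z 5 = - z 4" by (simp only: add_eq_0_iff)
    have 2: "z 2 = - z 4" using K(2)[of 0] by (simp add: A B 5)
    have 3: "z 3 = - z 4" using K(2)[of 1] by (simp add: A B 5)
    have 0: "z 0 = 2 * z 4" using K(3)[of 0] by (simp add: A 2 3 5)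
    obtain j' where "j' < 1 + 1" "z (4 + j') \<noteq> 0"
      using k[unfolded dims] j[unfolded dims] by (rule kernel_tail_nonzero)
    then have "z 4 \<noteq> 0" using 5 by (auto simp: less_Suc_eq)
    then show "\<exists>S. finite S \<and> 4 < card S \<and> (\<forall>j\<in>S. z j \<noteq> 0)"
      by (intro five_nonzero[of 0 2 3 4 5]) (simp_all add: 0 2 3 5 two)
  qed
  have "[0..<1 + 5] = [0, 1, 2, 3, 4, 5]" by (simp add: upt_rec)
  then have slopes: "map (col_slope G) [0..<1 + 5] = [Some 0, None, Some 2, Some 1, Some (-2), Some (-1)]"
    using col_slopes(1-4) col_slopes(5)[of 0] col_slopes(5)[of 1] by (simp add: A slope_def)
  \<comment> \<open>Six columns on four points force coincidences over GF(3), hence the different lower bound.\<close>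
  have bal: "card {j. j < 1 + 5 \<and> col_slope G j = t} \<in>
      {if CARD('s) = 3 then 1 else 0, (if CARD('s) = 3 then 1 else 0) + 1}" for t
  proof (cases "CARD('s) = 3")
    case True
    note GF3 = GF3_facts[OF True]
    have "t \<in> {None, Some 0, Some 1, Some 2}" using GF3(1) by (cases t) auto
    then show ?thesis
      unfolding card_fibre_eq_count slopes GF3(2,3)
      by (elim insertE) (simp_all add: True GF3(4,5) GF3(4,5)[symmetric])
  next
    case False
    then have "5 \<le> CARD('s)" using odd_CARD_cases[OF odd] by auto
    then have "distinct (map (col_slope G) [0..<1 + 5])"
      unfolding slopes
      by (simp add: numeral_mod_ring_eq_one numeral_mod_ring_neq_zero neg_eq_iff_add_eq_0 eq_neg_iff_add_eq_0 one_eq_numeral_mod_ring)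
    then show ?thesis using balanced_if_distinct[of "col_slope G" "1 + 5" t] False by simp
  qed
  have "yields_2fi_optimal 2 (1 + 2) (1 + 5) G"
  proof (rule stacked_M0_optimal[OF odd st _ _ _ _ ind bal])
    show "\<exists>x. \<forall>i<1. (\<Sum>j<1 + 1. x j * C $$ (i, j)) = y i" for y
      by (rule exI[of _ "\<lambda>j. if j = 0 then y 0 else 0"]) (simp add: C)
    show "A $$ (0, j) \<noteq> 0 \<or> A $$ (1, j) \<noteq> 0" if "j < 1 + 1" for j
      using that A by (auto simp: less_Suc_eq)
    show "\<exists>i<1. C $$ (i, j) \<noteq> 0" if "j < 1 + 1" for j
      using that C by (auto simp: less_Suc_eq)
    show "(\<exists>i<2. \<exists>i'<1. B $$ (i, j) * C $$ (i', j') \<noteq> C $$ (i', j) * B $$ (i, j')) \<or>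
        (\<exists>i<1. \<exists>i'<1. C $$ (i, j) * C $$ (i', j') \<noteq> C $$ (i', j) * C $$ (i, j'))"
      if "j < j'" "j' < 1 + 1" for j j'
    proof -
      have "j = 0" "j' = 1" using that by auto
      then show ?thesis by (intro disjI1 exI[of _ 0]) (simp add: B C)
    qed
  qed
  then show ?thesis by (simp add: G_q3_stacked A_def B_def C_def del: add_2_eq_Suc')
qed

lemma G_q4_stacked:
  "(G_q4 :: 's::prime_card mod_ring mat) = stacked_generator M0
     (column [1, of_nat (CARD('s) - 1)] @\<^sub>c column [1, of_nat (CARD('s) - 2)] @\<^sub>c
       column [1, of_nat (CARD('s) - 3)])
     (column [0, 1] @\<^sub>c 0\<^sub>m 2 1 @\<^sub>c 0\<^sub>m 2 1) (ones 2 @\<^sub>c column [1, 2] @\<^sub>c column [0, 1])"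
  by (simp add: G_q4_def stacked_generator_def Let_def ones_def)

lemma ones_index [simp]: "i < v \<Longrightarrow> ones v $$ (i, 0) = 1" "dim_row (ones v) = v" "dim_col (ones v) = 1"
  by (simp_all add: ones_def)

text \<open>
  The kernel vector with entry 1 at index 4 is (1, *, 1, -3, 1, -1, 1), which has weight at
  least five in every odd characteristic. The slopes 0, infinity, 2, 1, -1, -2, -3 are pairwise
  distinct for s at least 7 and cover each point once or twice for s = 3 and s = 5.
\<close>

lemma G_q4_optimal:
  assumes odd: "odd (CARD('s::prime_card))"
  shows "yields_2fi_optimal 2 4 7 (G_q4 :: 's mod_ring mat)"
proof -
  define A B C :: "'s mod_ring mat"
    where "A = column [1, of_nat (CARD('s) - 1)] @\<^sub>c column [1, of_nat (CARD('s) - 2)] @\<^sub>c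
        column [1, of_nat (CARD('s) - 3)]"
      and "B = column [0, 1] @\<^sub>c 0\<^sub>m 2 1 @\<^sub>c 0\<^sub>m 2 1"
      and "C = ones 2 @\<^sub>c column [1, 2] @\<^sub>c column [0, 1]"
  have st: "stacked 2 M0 A B C"
    by (auto simp: stacked_def A_def B_def C_def append_cols_def mat_of_cols_list_def ones_def)
  interpret stacked 2 M0 A B C by (rule st)
  note two = two_neq_zero_mod_ring[OF odd]
  have card3: "3 \<le> CARD('s)" using odd_CARD_cases[OF odd] by auto
  have A: "A $$ (0, 0) = 1" "A $$ (0, Suc 0) = 1" "A $$ (0, 2) = 1"
    "A $$ (Suc 0, 0) = -1" "A $$ (Suc 0, Suc 0) = -2" "A $$ (Suc 0, 2) = -3"
    using card3 by (simp_all add: A_def append_cols_index of_nat_CARD_diff)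
  have B: "B $$ (0, j) = 0" "B $$ (Suc 0, j) = (if j = 0 then 1 else 0)" if "j < 3" for j
    using that by (auto simp: B_def append_cols_index)
  have C: "C $$ (0, 0) = 1" "C $$ (0, Suc 0) = 1" "C $$ (0, 2) = 0"
    "C $$ (Suc 0, 0) = 1" "C $$ (Suc 0, Suc 0) = 2" "C $$ (Suc 0, 2) = 1"
    by (simp_all add: C_def append_cols_index)
  have sum3: "(\<Sum>j<2 + 1. f j) = f 0 + f 1 + f 2" for f :: "nat \<Rightarrow> 's mod_ring"
    by (simp add: numeral_3_eq_3 numeral_2_eq_2)
  have ind: "columns_independent_upto 4 G"
  proof (rule columns_independent_upto_if_weight)
    fix z j assume k: "\<forall>i<dim_row G. (\<Sum>j<dim_col G. z j * G $$ (i, j)) = 0" and j: "j < dim_col G" "z j \<noteq> 0"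
    note K = kernel[OF k[unfolded dims], unfolded sum3]
    have "z 4 + z 5 = 0" using K(1)[of 0] by (simp add: C)
    then have 5: "z 5 = - z 4" by (simp only: add_eq_0_iff)
    have 6: "z 6 = z 4" using K(1)[of 1] by (simp add: C 5)
    have 2: "z 2 = z 4" using K(2)[of 0] by (simp add: A B 5 6)
    have 3: "z 3 = - 3 * z 4" using K(2)[of 1] by (simp add: A B 5 6)
    have 0: "z 0 = z 4" using K(3)[of 0] by (simp add: A 2 3 5 6)
    obtain j' where "j' < 2 + 1" "z (4 + j') \<noteq> 0"
      using k[unfolded dims] j[unfolded dims] by (rule kernel_tail_nonzero)
    then have "z 4 \<noteq> 0" using 5 6 by (auto simp: less_Suc_eq numeral_3_eq_3)
    then show "\<exists>S. finite S \<and> 4 < card S \<and> (\<forall>j\<in>S. z j \<noteq> 0)"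
      by (intro five_nonzero[of 0 2 4 5 6]) (simp_all add: 0 2 5 6)
  qed
  have "[0..<2 + 5] = [0, 1, 2, 3, 4, 5, 6]" by (simp add: upt_rec)
  then have slopes: "map (col_slope G) [0..<2 + 5] =
      [Some 0, None, Some 2, Some 1, Some (-1), Some (-2), Some (-3)]"
    using col_slopes(1-4) col_slopes(5)[of 0] col_slopes(5)[of 1] col_slopes(5)[of 2]
    by (simp add: A slope_def)
  \<comment> \<open>Seven columns exceed the number s + 1 of points exactly for s = 3 and s = 5.\<close>
  define a :: nat where "a = (if CARD('s) \<le> 5 then 1 else 0)"
  have bal: "card {j. j < 2 + 5 \<and> col_slope G j = t} \<in> {a, a + 1}" for t
    using odd_CARD_cases[OF odd]
  proof (elim disjE)
    assume s: "CARD('s) = 3"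
    note GF3 = GF3_facts[OF s]
    have "t \<in> {None, Some 0, Some 1, Some 2}" using GF3(1) by (cases t) auto
    then show ?thesis
      unfolding card_fibre_eq_count slopes GF3(2,3)
      by (elim insertE) (simp_all add: a_def s GF3(4-6) GF3(4,5)[symmetric])
  next
    assume s: "CARD('s) = 5"
    note GF5 = GF5_facts[OF s]
    have "t \<in> {None, Some 0, Some 1, Some 2, Some 3, Some 4}" using GF5(1) by (cases t) auto
    then show ?thesis
      unfolding card_fibre_eq_count slopes GF5(2-)
      by (elim insertE) (simp_all add: a_def s numeral_mod_ring_eq numeral_mod_ring_neq_zero
          numeral_mod_ring_eq_one one_eq_numeral_mod_ring)
  next
    assume s: "7 \<le> CARD('s)"
    then have "distinct (map (col_slope G) [0..<2 + 5])"
      unfolding slopes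
      by (simp add: numeral_mod_ring_eq numeral_mod_ring_eq_one numeral_mod_ring_neq_zero
          neg_eq_iff_add_eq_0 eq_neg_iff_add_eq_0 one_eq_numeral_mod_ring)
    then show ?thesis using balanced_if_distinct[of "col_slope G" "2 + 5" t] s by (simp add: a_def)
  qed
  have "yields_2fi_optimal 2 (2 + 2) (2 + 5) G"
  proof (rule stacked_M0_optimal[OF odd st _ _ _ _ ind bal])
    fix y :: "nat \<Rightarrow> 's mod_ring"
    show "\<exists>x. \<forall>i<2. (\<Sum>j<2 + 1. x j * C $$ (i, j)) = y i"
      unfolding sum3
      by (rule exI[of _ "\<lambda>j. if j = 0 then y 0 else if j = 1 then 0 else y 1 - y 0"])
        (auto simp: C less_2_cases_iff)
  next
    fix j :: nat assume j: "j < 2 + 1"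
    then have j: "j = 0 \<or> j = Suc 0 \<or> j = 2" by linarith
    then show "A $$ (0, j) \<noteq> 0 \<or> A $$ (1, j) \<noteq> 0" using A by auto
    have "C $$ (1, j) \<noteq> 0" using j C two by auto
    then show "\<exists>i<2. C $$ (i, j) \<noteq> 0" by (intro exI[of _ 1]) simp
  next
    fix j j' :: nat assume j: "j < j'" "j' < 2 + 1"
    then have "j = 0 \<and> j' = Suc 0 \<or> j = 0 \<and> j' = 2 \<or> j = Suc 0 \<and> j' = 2" by linarith
    moreover have "(2 :: 's mod_ring) \<noteq> 1" using card3 by (simp add: numeral_mod_ring_eq_one)
    ultimately have "C $$ (0, j) * C $$ (1, j') \<noteq> C $$ (1, j) * C $$ (0, j')"
      using C by auto
    then show "(\<exists>i<2. \<exists>i'<2. B $$ (i, j) * C $$ (i', j') \<noteq> C $$ (i', j) * B $$ (i, j')) \<or>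
        (\<exists>i<2. \<exists>i'<2. C $$ (i, j) * C $$ (i', j') \<noteq> C $$ (i', j) * C $$ (i, j'))"
      by (intro disjI2 exI[of _ 0] exI[of _ 1] conjI) simp_all
  qed
  then show ?thesis by (simp add: G_q4_stacked A_def B_def C_def del: add_2_eq_Suc')
qed

lemma a_ge5_simps [simp]:
  "dim_row (a_ge5 :: 's::prime_card mod_ring mat) = 2" "dim_col (a_ge5 :: 's mod_ring mat) = 1"
  "(a_ge5 :: 's mod_ring mat) $$ (0, 0) = 1" "(a_ge5 :: 's mod_ring mat) $$ (Suc 0, 0) = -1"
  using prime_gt_0_nat[OF prime_card[where 'a='s]] by (simp_all add: a_ge5_def of_nat_CARD_diff)

lemma G_ge5_stacked:
  "G_ge5 q X = stacked_generator M0 (a_ge5 @\<^sub>c X) (a_ge5 @\<^sub>c 0\<^sub>m 2 (q - 2))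
     (ones (q - 2) @\<^sub>c 1\<^sub>m (q - 2))"
  by (simp add: G_ge5_def stacked_generator_def)

text \<open>
  A nonzero kernel vector has the entry t at index 4 and the entry -t at each of the k later
  indices, with t nonzero. These are k + 1 nonzero entries, at least four. If the entries 2 and
  3 vanish, then the upper rows give the entry -t at index 0; hence a fifth nonzero entry exists
  in any case. The rows of the array cost nothing because the columns (1,...,1) and the unit
  vectors of C are pairwise independent for k at least 3.
\<close>

lemma G_ge5_optimal:
  fixes X :: "'s::prime_card mod_ring mat"
  assumes odd: "odd (CARD('s))" and k: "3 \<le> k"
    and X: "X \<in> carrier_mat 2 k" and X0: "\<And>j. j < k \<Longrightarrow> X $$ (0, j) \<noteq> 0 \<or> X $$ (1, j) \<noteq> 0"
    and bal: "\<And>t. card {j. j < k + 5 \<and> col_slope (G_ge5 (k + 2) X) j = t} \<in> {a, a + 1}"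
  shows "yields_2fi_optimal 2 (k + 2) (k + 5) (G_ge5 (k + 2) X)"
proof -
  define A B C :: "'s mod_ring mat"
    where "A = a_ge5 @\<^sub>c X" and "B = a_ge5 @\<^sub>c 0\<^sub>m 2 k" and "C = ones k @\<^sub>c 1\<^sub>m k"
  have G: "G_ge5 (k + 2) X = stacked_generator M0 A B C"
    by (simp add: G_ge5_stacked A_def B_def C_def)
  have st: "stacked k M0 A B C"
    unfolding stacked_def using X
    by (intro conjI carrier_matI) (simp_all add: A_def B_def C_def)
  interpret stacked k M0 A B C by (rule st)
  have A0: "A $$ (0, 0) = 1"
    using X by (simp add: A_def append_cols_index)
  have A: "A $$ (i, Suc j) = X $$ (i, j)" if "i < 2" "j < k" for i j
    using X that by (simp add: A_def append_cols_index)
  have AB: "A $$ (i, 0) - B $$ (i, 0) = 0" if "i < 2" for i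
    using X that by (simp add: A_def B_def append_cols_index)
  have B: "B $$ (i, Suc j) = 0" if "i < 2" "j < k" for i j
    using that by (simp add: B_def append_cols_index)
  have C0: "C $$ (i, 0) = 1" if "i < k" for i
    using that by (simp add: C_def append_cols_index)
  have C: "C $$ (i, Suc j) = (if i = j then 1 else 0)" if "i < k" "j < k" for i j
    using that by (simp add: C_def append_cols_index)
  have sumC: "(\<Sum>j<k + 1. x j * C $$ (i, j)) = x 0 + x (Suc i)" if "i < k" for x i
    unfolding Suc_eq_plus1[symmetric] sum.lessThan_Suc_shift
    using that by (simp add: C0 C if_distrib sum.delta cong: if_cong)
  have ind: "columns_independent_upto 4 G"
  proof (rule columns_independent_upto_if_weight)
    fix z j assume ker: "\<forall>i<dim_row G. (\<Sum>j<dim_col G. z j * G $$ (i, j)) = 0" and j: "j < dim_col G" "z j \<noteq> 0"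
    note K = kernel[OF ker[unfolded dims]]
    have tail: "z (4 + Suc i) = - z 4" if "i < k" for i
      using K(1)[OF that] unfolding sumC[OF that] by (simp add: add_eq_0_iff)
    obtain j' where "j' < k + 1" "z (4 + j') \<noteq> 0"
      using ker[unfolded dims] j[unfolded dims] by (rule kernel_tail_nonzero)
    then have 4: "z 4 \<noteq> 0" using tail[of "j' - 1"] by (cases j') auto
    \<comment> \<open>The indices 4 to 7 are nonzero because k is at least 3.\<close>
    have S: "\<exists>S. finite S \<and> 4 < card S \<and> (\<forall>j\<in>S. z j \<noteq> 0)" if "i < 4" "z i \<noteq> 0" for i
      using that 4 k tail[of 0] tail[of 1] tail[of 2]
      by (intro five_nonzero[of i 4 5 6 7]) auto
    show "\<exists>S. finite S \<and> 4 < card S \<and> (\<forall>j\<in>S. z j \<noteq> 0)"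
    proof (cases "z 2 = 0 \<and> z 3 = 0")
      case True
      have "(\<Sum>j<k + 1. z (4 + j) * A $$ (0, j)) = z 4 + (\<Sum>j<k. z (4 + Suc j) * X $$ (0, j))"
        unfolding Suc_eq_plus1[symmetric] sum.lessThan_Suc_shift by (simp add: A0 A)
      moreover have "(\<Sum>j<k + 1. z (4 + j) * (A $$ (0, j) - B $$ (0, j)))
          = (\<Sum>j<k. z (4 + Suc j) * X $$ (0, j))"
        unfolding Suc_eq_plus1[symmetric] sum.lessThan_Suc_shift by (simp add: AB A B)
      ultimately have "z 0 = - z 4"
        using K(2)[of 0] K(3)[of 0] True by simp
      then show ?thesis using S[of 0] 4 by simp
    next
      case False
      then show ?thesis using S[of 2] S[of 3] by auto
    qed
  qed
  show ?thesis
    unfolding G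
  proof (rule stacked_M0_optimal[OF odd st _ _ _ _ ind bal[unfolded G]])
    fix y :: "nat \<Rightarrow> 's mod_ring"
    show "\<exists>x. \<forall>i<k. (\<Sum>j<k + 1. x j * C $$ (i, j)) = y i"
      by (rule exI[of _ "\<lambda>j. if j = 0 then 0 else y (j - 1)"]) (intro allI impI, subst sumC, assumption, simp)
  next
    fix j :: nat assume "j < k + 1"
    then show "A $$ (0, j) \<noteq> 0 \<or> A $$ (1, j) \<noteq> 0"
      using X0[of "j - 1"] A[of 0 "j - 1"] A[of 1 "j - 1"] A0 by (cases j) auto
    have "C $$ (j - 1, j) \<noteq> 0"
      using \<open>j < k + 1\<close> k C0[of 0] C[of "j - 1" "j - 1"] by (cases j) auto
    then show "\<exists>i<k. C $$ (i, j) \<noteq> 0"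
      using \<open>j < k + 1\<close> k by (intro exI[of _ "j - 1"]) auto
  next
    fix j j' :: nat assume j: "j < j'" "j' < k + 1"
    \<comment> \<open>A row in which the identity part has zeros in both columns; it distinguishes the all-ones
      column from a unit vector.\<close>
    obtain i where i: "i < k" "i \<noteq> j - 1" "i \<noteq> j' - 1"
    proof -
      have "card {j - 1, j' - 1} < card {..<k}" using k by (simp add: card_insert_if)
      then have "\<not> {..<k} \<subseteq> {j - 1, j' - 1}" using card_mono[of "{j - 1, j' - 1}" "{..<k}"] by auto
      then show thesis using that by auto
    qed
    obtain m' where m': "j' = Suc m'" "m' < k" using j by (cases j') auto
    have "\<exists>i<k. C $$ (i, j) * C $$ (m', j') \<noteq> C $$ (m', j) * C $$ (i, j')"
    proof (cases j)
      case 0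
      then have "C $$ (i, j) * C $$ (m', j') \<noteq> C $$ (m', j) * C $$ (i, j')"
        using i m' by (simp add: C0 C)
      then show ?thesis using i(1) by blast
    next
      case (Suc m)
      have m: "m < k" "m \<noteq> m'" using j Suc m' by linarith+
      then have "C $$ (m, j) * C $$ (m', j') \<noteq> C $$ (m', j) * C $$ (m, j')"
        using m' Suc by (simp add: C)
      then show ?thesis using m(1) by blast
    qed
    then have "\<exists>i<k. \<exists>i'<k. C $$ (i, j) * C $$ (i', j') \<noteq> C $$ (i', j) * C $$ (i, j')"
      using m'(2) by blast
    then show "(\<exists>i<2. \<exists>i'<k. B $$ (i, j) * C $$ (i', j') \<noteq> C $$ (i', j) * B $$ (i, j')) \<or>
        (\<exists>i<k. \<exists>i'<k. C $$ (i, j) * C $$ (i', j') \<noteq> C $$ (i', j) * C $$ (i, j'))" ..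
  qed
qed

section \<open>The generators for q = 2\<close>

lemma append_rows_no_rows:
  assumes "dim_row Z = 0"
  shows "Y @\<^sub>r Z = Y"
  using assms by (intro eq_matI) (simp_all add: append_rows_def)

text \<open>
  The block M that replaces \<open>M0\<close> when q = 2 and s is at least 5.
\<close>

definition M1 :: "'s::prime_card mod_ring mat" where
  "M1 = mat_of_rows_list 2 [[1, 1], [3, 2]]"

lemma M1_carrier [simp]: "M1 \<in> carrier_mat 2 2"
  by (auto simp: M1_def mat_of_rows_list_def)

lemma M1_index [simp]:
  "M1 $$ (0, 0) = 1" "M1 $$ (0, Suc 0) = 1" "M1 $$ (Suc 0, 0) = 3" "M1 $$ (Suc 0, Suc 0) = 2"
  by (simp_all add: M1_def mat_of_rows_list_def)

text \<open>
  For q = 2 the bottom block row is empty, which is why C has no rows.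
\<close>

lemma G_q2_stacked:
  "CARD('s::prime_card) = 3 \<Longrightarrow> (G_q2 :: 's mod_ring mat) =
     stacked_generator M0 (column [1, 2]) (column [2, 0]) (0\<^sub>m 0 1)"
  "CARD('s) \<noteq> 3 \<Longrightarrow> (G_q2 :: 's mod_ring mat) =
     stacked_generator M1 (column [1, 1]) (column [2, 2]) (0\<^sub>m 0 1)"
  by (simp_all add: G_q2_def stacked_generator_def append_rows_no_rows M1_def Let_def)

context stacked
begin

lemma entries_r_head:
  "G $$ (2, 0) = 1" "G $$ (3, 0) = 0" "G $$ (2, 1) = 0" "G $$ (3, 1) = 1"
  "G $$ (2, 2) = M $$ (0, 0) + 1" "G $$ (3, 2) = M $$ (1, 0)"
  "G $$ (2, 3) = M $$ (0, 1)" "G $$ (3, 3) = M $$ (1, 1) + 1"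
  "G $$ (2, 4) = B $$ (0, 0)" "G $$ (3, 4) = B $$ (1, 0)"
  using entry_middle[of _ 0] entry_middle[of _ 1] entry_tail[of _ 0] by (simp_all add: entry_head)

end

lemma pairs_below_5:
  assumes "l < m" "m < (5::nat)"
  shows "l = 0 \<and> m = 1 \<or> l = 0 \<and> m = 2 \<or> l = 0 \<and> m = 3 \<or> l = 0 \<and> m = 4 \<or> l = 1 \<and> m = 2
    \<or> l = 1 \<and> m = 3 \<or> l = 1 \<and> m = 4 \<or> l = 2 \<and> m = 3 \<or> l = 2 \<and> m = 4 \<or> l = 3 \<and> m = 4"
proof -
  have "m = 1 \<or> m = 2 \<or> m = 3 \<or> m = 4" "l = 0 \<or> l = 1 \<or> l = 2 \<or> l = 3" using assms by linarith+
  then show ?thesis using assms by auto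
qed

text \<open>
  The kernel is spanned by (1, 4, -1, -1, 1). Both halves have five pairwise distinct slopes, so
  all ten interactions are unconfounded.
\<close>

lemma G_q2_optimal_ge5:
  assumes s: "5 \<le> CARD('s::prime_card)"
  shows "yields_2fi_optimal 2 2 5 (G_q2 :: 's mod_ring mat)"
proof -
  define A B C :: "'s mod_ring mat" where "A = column [1, 1]" and "B = column [2, 2]" and "C = 0\<^sub>m 0 1"
  have st: "stacked 0 M1 A B C"
    by (auto simp: stacked_def A_def B_def C_def mat_of_cols_list_def)
  interpret stacked 0 M1 A B C by (rule st)
  have G: "G_q2 = G" using s by (simp add: G_q2_stacked A_def B_def C_def)
  have A: "A $$ (0, 0) = 1" "A $$ (Suc 0, 0) = 1" by (simp_all add: A_def)
  have B: "B $$ (0, 0) = 2" "B $$ (Suc 0, 0) = 2" by (simp_all add: B_def)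
  note num = numeral_mod_ring_eq[where 's='s] numeral_mod_ring_eq_one[where 's='s]
    numeral_mod_ring_neq_zero[where 's='s] one_eq_numeral_mod_ring[where 's='s]
  \<comment> \<open>The minors of the lower half involve 6 against 2, 3 and 4; the bound on s does not give 6 <
    s, so these come from the prime factors of the differences.\<close>
  have num6: "(6 :: 's mod_ring) \<noteq> 2" "(6 :: 's mod_ring) \<noteq> 4" "(6 :: 's mod_ring) \<noteq> 3" "(6 :: 's mod_ring) \<noteq> 0"
  proof -
    have "(2 :: 's mod_ring) * 3 \<noteq> 0" using s by (simp only: mult_eq_0_iff) (simp add: numeral_mod_ring_neq_zero)
    then show "(6 :: 's mod_ring) \<noteq> 0" by simp
    have "(6 :: 's mod_ring) - 2 = 4" "(6 :: 's mod_ring) - 4 = 2" "(6 :: 's mod_ring) - 3 = 3" by simp_all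
    moreover have "(4 :: 's mod_ring) \<noteq> 0" "(2 :: 's mod_ring) \<noteq> 0" "(3 :: 's mod_ring) \<noteq> 0"
      using s by (simp_all add: numeral_mod_ring_neq_zero)
    ultimately show "(6 :: 's mod_ring) \<noteq> 2" "(6 :: 's mod_ring) \<noteq> 4" "(6 :: 's mod_ring) \<noteq> 3"
      by (metis diff_self)+
  qed
  have ind: "columns_independent_upto 4 G"
  proof (rule columns_independent_upto_if_weight)
    fix z j assume k: "\<forall>i<dim_row G. (\<Sum>j<dim_col G. z j * G $$ (i, j)) = 0" and j: "j < dim_col G" "z j \<noteq> 0"
    note K = kernel[OF k[unfolded dims]]
    have 2: "z 2 = - z 4" using K(2)[of 0] by (simp add: A B)
    have 3: "z 3 = - z 4" using K(2)[of 1] by (simp add: A B)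
    have 0: "z 0 = z 4" using K(3)[of 0] by (simp add: A 2 3)
    have 1: "z 1 = 4 * z 4" using K(3)[of 1] by (simp add: A 2 3)
    obtain j' where "j' < 0 + 1" "z (4 + j') \<noteq> 0"
      using k[unfolded dims] j[unfolded dims] by (rule kernel_tail_nonzero)
    then have "z 4 \<noteq> 0" by simp
    moreover have "(4 :: 's mod_ring) \<noteq> 0" using s by (simp add: num)
    ultimately have "z 0 \<noteq> 0" "z 1 \<noteq> 0" "z 2 \<noteq> 0" "z 3 \<noteq> 0" "z 4 \<noteq> 0"
      unfolding 0 1 2 3 by simp_all
    then show "\<exists>S. finite S \<and> 4 < card S \<and> (\<forall>j\<in>S. z j \<noteq> 0)"
      by (intro five_nonzero[of 0 1 2 3 4]) simp_all
  qed
  have "[0..<0 + 5] = [0, 1, 2, 3, 4]" by (simp add: upt_rec)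
  then have slopes: "map (col_slope G) [0..<0 + 5] = [Some 0, None, Some 3, Some 2, Some 1]"
    using col_slopes(1-4) col_slopes(5)[of 0] by (simp add: A slope_def)
  have "distinct (map (col_slope G) [0..<0 + 5])"
    unfolding slopes using s by (simp add: num)
  note bal = balanced_if_distinct[OF this]
  have r: "\<not> cols_dependent (gen_r 2 G) {l, m}" if lm: "l < m" "m < 5" for l m
  proof (rule gen_r_pair_independent_if_minor[where i=2 and i'=3])
    show "G $$ (2, l) * G $$ (3, m) \<noteq> G $$ (3, l) * G $$ (2, m)"
      using pairs_below_5[OF lm] s entries_r_head B num6
      by (elim disjE conjE) (simp_all add: num)
  qed (use lm in simp_all)
  have "yields_2fi_optimal 2 (0 + 2) (0 + 5) G"
  proof (rule optimal_if_balanced[OF _ ind _ _ bal])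
    have "vec_space.rank (0 + 4) G = 0 + 4" by (rule rank) simp
    then show "array_generator 2 (0 + 2) (0 + 5) G"
      using carrier by (simp add: array_generator_def)
    show "\<not> cols_dependent (gen_c 2 G) {j}" if "j < 0 + 5" for j
      by (rule gen_c_columns_nonzero[OF _ _ _ that]) (simp_all add: A)
    show "\<not> cols_dependent (gen_r 2 G) {l, m}" if "l < m" "m < 0 + 5" for l m
      using r that by simp
  qed
  then show ?thesis by (simp add: G numeral_2_eq_2)
qed

section \<open>The case q = 2 over GF(3)\<close>

text \<open>
  The four points (a, b), (x1, y1), (x2, y2), (x3, y3) exhaust the projective line over GF(3).
  The determinants of (a, b) with the three vectors are nonzero and add up to zero, so they are
  all equal. Hence the three vectors differ from the first one by multiples of (a, b) with
  distinct factors 0, u, v, and 0 + u + v = 0. Their sum is therefore three times the first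
  vector, that is zero, and nothing is left for (p, q).
\<close>

lemma GF3_four_points:
  fixes a b p q x1 y1 x2 y2 x3 y3 :: "'s::prime_card mod_ring"
  assumes s: "CARD('s) = 3"
    and D: "a * y1 \<noteq> b * x1" "a * y2 \<noteq> b * x2" "a * y3 \<noteq> b * x3"
    and E: "x1 * y2 \<noteq> x2 * y1" "x1 * y3 \<noteq> x3 * y1" "x2 * y3 \<noteq> x3 * y2"
    and par: "a * q = b * p"
    and sum: "x1 + x2 + x3 + p = 0" "y1 + y2 + y3 + q = 0"
  shows "p = 0 \<and> q = 0"
proof -
  define d where "d = a * y1 - b * x1"
  have "d \<noteq> 0" using D(1) by (simp add: d_def)
  have "d + (a * y2 - b * x2) + (a * y3 - b * x3) = a * (y1 + y2 + y3 + q) - b * (x1 + x2 + x3 + p) - (a * q - b * p)"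
    by (simp add: d_def algebra_simps)
  also have "\<dots> = 0" by (simp add: sum par)
  finally have z: "d + (a * y2 - b * x2) + (a * y3 - b * x3) = 0" .
  have "a * y2 - b * x2 = d" "a * y3 - b * x3 = d"
    using GF3_sum_three_nonzero[OF s \<open>d \<noteq> 0\<close> _ _ z] D(2,3) by auto
  then have eq: "a * (y2 - y1) = b * (x2 - x1)" "a * (y3 - y1) = b * (x3 - x1)"
    by (simp_all add: d_def algebra_simps)
  have "a \<noteq> 0 \<or> b \<noteq> 0" using D(1) by auto
  then have ex: "\<exists>u. x = u * a \<and> y = u * b" if "a * y = b * x" for x y
  proof
    assume "a \<noteq> 0"
    then show ?thesis using that by (intro exI[of _ "x / a"]) (simp add: field_simps)
  next
    assume "b \<noteq> 0"
    then show ?thesis using that by (intro exI[of _ "y / b"]) (simp add: field_simps)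
  qed
  obtain u where "x2 - x1 = u * a" "y2 - y1 = u * b" using ex[OF eq(1)] by blast
  then have u: "x2 = x1 + u * a" "y2 = y1 + u * b" by (simp_all add: diff_eq_eq add.commute)
  obtain v where "x3 - x1 = v * a" "y3 - y1 = v * b" using ex[OF eq(2)] by blast
  then have v: "x3 = x1 + v * a" "y3 = y1 + v * b" by (simp_all add: diff_eq_eq add.commute)
  have "u \<noteq> 0" "v \<noteq> 0" "u \<noteq> v" using E by (auto simp: u v)
  then have uv: "u + v = 0" by (rule GF3_distinct_nonzero[OF s])
  have three: "(3 :: 's mod_ring) = 0" using GF3_facts(6)[OF s] .
  have "p = x1 + x2 + x3 + p - 3 * x1 - (u + v) * a" "q = y1 + y2 + y3 + q - 3 * y1 - (u + v) * b"
    by (simp_all add: u v algebra_simps)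
  then show ?thesis unfolding sum uv three by simp
qed

text \<open>
  Five columns, four points.
\<close>

lemma GF3_dependent_pair:
  fixes A :: "'s::prime_card mod_ring mat"
  assumes s: "CARD('s) = 3" and A: "A \<in> carrier_mat 2 5"
    and nz: "\<And>j. j < 5 \<Longrightarrow> \<not> cols_dependent A {j}"
  obtains l m where "l \<noteq> m" "l < 5" "m < 5" "cols_dependent A {l, m}"
proof -
  have "card (col_slope A ` {..<5}) \<le> CARD('s mod_ring option)" by (rule card_mono) auto
  also have "\<dots> < card {..<5::nat}" using s by simp
  finally have "\<not> inj_on (col_slope A) {..<5}" by (rule pigeonhole)
  then obtain l m where "l \<noteq> m" "l < 5" "m < 5" "col_slope A l = col_slope A m"
    by (auto simp: inj_on_def)
  then show thesis using that cols_dependent_two_rows[OF A] nz by blast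
qed

text \<open>
  If only one pair of the five columns is dependent, then the other three columns and this pair
  occupy the four points of the line. In a relation with all coefficients nonzero the scaled
  columns satisfy the hypotheses of \<open>GF3_four_points\<close>, so the two terms of the dependent pair
  cancel each other.
\<close>

lemma GF3_cancelling_pair:
  fixes A :: "'s::prime_card mod_ring mat"
  assumes s: "CARD('s) = 3" and A: "A \<in> carrier_mat 2 5"
    and nz: "\<And>j. j < 5 \<Longrightarrow> \<not> cols_dependent A {j}"
    and w: "\<And>j. j < 5 \<Longrightarrow> w j \<noteq> 0"
    and ker: "\<And>i. i < 2 \<Longrightarrow> (\<Sum>j<5. w j * A $$ (i, j)) = 0"
    and lm: "l \<noteq> m" "l < 5" "m < 5" "cols_dependent A {l, m}"
    and only: "\<And>l' m'. l' \<noteq> m' \<Longrightarrow> l' < 5 \<Longrightarrow> m' < 5 \<Longrightarrow> cols_dependent A {l', m'} \<Longrightarrow> {l', m'} = {l, m}"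
    and i: "i < 2"
  shows "w l * A $$ (i, l) + w m * A $$ (i, m) = 0"
proof -
  have "card ({..<5} - {l, m}) = 3" using lm by (subst card_Diff_subset) auto
  then obtain j1 j2 j3 where J: "{..<5} - {l, m} = {j1, j2, j3}" "j1 \<noteq> j2" "j2 \<noteq> j3" "j1 \<noteq> j3"
    by (auto simp: card_3_iff)
  have j: "j1 < 5" "j2 < 5" "j3 < 5" "j1 \<noteq> l" "j2 \<noteq> l" "j3 \<noteq> l" "j1 \<noteq> m" "j2 \<noteq> m" "j3 \<noteq> m"
    using J(1) by auto
  have split: "(\<Sum>j<5. w j * A $$ (i, j)) = w j1 * A $$ (i, j1) + w j2 * A $$ (i, j2) + w j3 * A $$ (i, j3)
      + (w l * A $$ (i, l) + w m * A $$ (i, m))" for i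
  proof -
    have "{..<5} = insert j1 (insert j2 (insert j3 (insert l (insert m {}))))" using J(1) lm by auto
    then show ?thesis using J(2-) j lm(1) by (simp add: add.assoc)
  qed
  have nondep: "A $$ (0, j) * A $$ (1, j') \<noteq> A $$ (0, j') * A $$ (1, j)"
    if "j \<noteq> j'" "j < 5" "j' < 5" "{j, j'} \<noteq> {l, m}" for j j'
    using only[of j j'] that cols_dependent_two_rows_det[OF A that(1-3) nz nz] by blast
  have dep: "A $$ (0, l) * A $$ (1, m) = A $$ (0, m) * A $$ (1, l)"
    using cols_dependent_two_rows_det[OF A lm(1-3) nz nz] lm by blast
  have scaled: "w j * A $$ (0, j) * (w j' * A $$ (1, j')) \<noteq> w j' * A $$ (0, j') * (w j * A $$ (1, j))"
    if "j \<noteq> j'" "j < 5" "j' < 5" "{j, j'} \<noteq> {l, m}" for j j'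
  proof
    assume "w j * A $$ (0, j) * (w j' * A $$ (1, j')) = w j' * A $$ (0, j') * (w j * A $$ (1, j))"
    then have "(w j * w j') * (A $$ (0, j) * A $$ (1, j')) = (w j * w j') * (A $$ (0, j') * A $$ (1, j))"
      by (simp only: mult_ac)
    then show False using nondep[OF that] w that by (simp only: mult_cancel_left mult_eq_0_iff) blast
  qed
  have scaled_l: "A $$ (0, l) * (w j * A $$ (1, j)) \<noteq> A $$ (1, l) * (w j * A $$ (0, j))"
    if "j < 5" "j \<noteq> l" "j \<noteq> m" for j
  proof
    assume "A $$ (0, l) * (w j * A $$ (1, j)) = A $$ (1, l) * (w j * A $$ (0, j))"
    then have "w j * (A $$ (0, l) * A $$ (1, j)) = w j * (A $$ (0, j) * A $$ (1, l))"
      by (simp only: mult_ac)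
    moreover have "{l, j} \<noteq> {l, m}" using that lm by auto
    ultimately show False using nondep[of l j] w[of j] that lm by simp
  qed
  have par: "A $$ (0, l) * (w l * A $$ (1, l) + w m * A $$ (1, m)) = A $$ (1, l) * (w l * A $$ (0, l) + w m * A $$ (0, m))"
  proof -
    have "A $$ (0, l) * (w l * A $$ (1, l) + w m * A $$ (1, m)) =
        A $$ (1, l) * (w l * A $$ (0, l)) + w m * (A $$ (0, l) * A $$ (1, m))" by (simp only: distrib_left mult_ac)
    also have "\<dots> = A $$ (1, l) * (w l * A $$ (0, l)) + w m * (A $$ (0, m) * A $$ (1, l))" unfolding dep ..
    also have "\<dots> = A $$ (1, l) * (w l * A $$ (0, l) + w m * A $$ (0, m))" by (simp only: distrib_left mult_ac)
    finally show ?thesis .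
  qed
  have k01: "w j1 * A $$ (0, j1) + w j2 * A $$ (0, j2) + w j3 * A $$ (0, j3)
      + (w l * A $$ (0, l) + w m * A $$ (0, m)) = 0"
    "w j1 * A $$ (1, j1) + w j2 * A $$ (1, j2) + w j3 * A $$ (1, j3)
      + (w l * A $$ (1, l) + w m * A $$ (1, m)) = 0"
    unfolding split[symmetric] by (rule ker, simp)+
  have ne: "{j1, j2} \<noteq> {l, m}" "{j1, j3} \<noteq> {l, m}" "{j2, j3} \<noteq> {l, m}" using j by blast+
  have "w l * A $$ (0, l) + w m * A $$ (0, m) = 0 \<and> w l * A $$ (1, l) + w m * A $$ (1, m) = 0"
    by (rule GF3_four_points[OF s scaled_l[of j1] scaled_l[of j2] scaled_l[of j3]
          scaled[of j1 j2] scaled[of j1 j3] scaled[of j2 j3] par])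
      (use j J(2-) ne k01 in simp_all)
  then show ?thesis using i by (auto simp: less_2_cases_iff)
qed

text \<open>
  Suppose that at most one of the ten interactions is confounded. Each half of G has a dependent
  pair of columns, and both pairs are confounded interactions; hence they are the same pair {l,
  m}, and it is the only dependent pair in either half. G has five columns and four rows, so it
  has a nonzero kernel vector w. If w had a zero, the remaining four columns would be dependent
  and any splitting of them into two pairs would give two confounded interactions. So w has no
  zero, and \<open>GF3_cancelling_pair\<close> applied to both halves with the same w makes the columns l and
  m of G dependent, which confounds two main effects.
\<close>

lemma GF3_num_unconfounded_2fi_le_8:
  fixes G :: "'s::prime_card mod_ring mat"
  assumes s: "CARD('s) = 3" and G: "G \<in> carrier_mat 4 5" and main: "main_effects_unconfounded 2 G"
  shows "num_unconfounded_2fi 2 G \<le> 8"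
proof (rule ccontr)
  let ?T = "two_factor_interactions 5"
  let ?U = "{E \<in> ?T. unconfounded 2 G E}"
  assume "\<not> num_unconfounded_2fi 2 G \<le> 8"
  then have "9 \<le> card ?U" using G by (simp add: num_unconfounded_2fi_def)
  moreover have "card ?T = 10"
    by (simp add: card_two_factor_interactions choose_two)
  ultimately have "card (?T - ?U) \<le> Suc 0"
    by (subst card_Diff_subset) auto
  then have one: "E = E'" if "E \<in> ?T - ?U" "E' \<in> ?T - ?U" for E E'
    using that by (subst (asm) card_le_Suc0_iff_eq) auto
  have confI: "{l, m} \<in> ?T - ?U"
    if "l \<noteq> m" "l < 5" "m < 5"
      "cols_dependent (gen_c 2 G) {l, m} \<or> cols_dependent (gen_r 2 G) {l, m} \<or>
       (\<exists>E'\<in>?T. E' \<noteq> {l, m} \<and> cols_dependent G ({l, m} \<union> E'))" for l m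
    using that G two_factor_interactionsI[of l m 5]
    by (auto simp: unconfounded_def confounded_with_effect_def confounded_with_columns_def
        confounded_with_rows_def)
  have c: "gen_c 2 G \<in> carrier_mat 2 5" "\<And>i j. i < 2 \<Longrightarrow> j < 5 \<Longrightarrow> gen_c 2 G $$ (i, j) = G $$ (i, j)"
    and r: "gen_r 2 G \<in> carrier_mat 2 5" "\<And>i j. i < 2 \<Longrightarrow> j < 5 \<Longrightarrow> gen_r 2 G $$ (i, j) = G $$ (2 + i, j)"
    using G by (auto simp: gen_c_def gen_r_def)
  have nz: "\<not> cols_dependent (gen_c 2 G) {j}" "\<not> cols_dependent (gen_r 2 G) {j}" if "j < 5" for j
    using main_effects_unconfoundedD[OF main, of j] that G by auto
  obtain l m where lm: "l \<noteq> m" "l < 5" "m < 5" "cols_dependent (gen_c 2 G) {l, m}"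
    using GF3_dependent_pair[OF s c(1) nz(1)] by blast
  obtain l' m' where lm': "l' \<noteq> m'" "l' < 5" "m' < 5" "cols_dependent (gen_r 2 G) {l', m'}"
    using GF3_dependent_pair[OF s r(1) nz(2)] by blast
  have lm_conf: "{l, m} \<in> ?T - ?U" using lm by (intro confI) auto
  have "{l', m'} \<in> ?T - ?U" using lm' by (intro confI) auto
  then have "{l', m'} = {l, m}" by (rule one[OF _ lm_conf])
  then have lm_r: "cols_dependent (gen_r 2 G) {l, m}" using lm'(4) by simp
  obtain w j0 where w: "j0 < 5" "w j0 \<noteq> 0" "\<And>i. i < 4 \<Longrightarrow> (\<Sum>j<5. w j * G $$ (i, j)) = 0"
    using cols_dependent_if_wide[OF G] G by (auto simp: cols_dependent_def)
  have full: "w j \<noteq> 0" if j: "j < 5" for j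
  proof
    assume "w j = 0"
    define J where "J = {..<5} - {j}"
    have "(\<Sum>j\<in>J. w j * G $$ (i, j)) = (\<Sum>j<5. w j * G $$ (i, j))" for i
      using \<open>w j = 0\<close> by (intro sum.mono_neutral_left) (auto simp: J_def)
    then have dep: "cols_dependent G J"
      unfolding cols_dependent_def using w \<open>w j = 0\<close> G
      by (intro exI[of _ w]) (auto simp: J_def)
    have cardJ: "card J = 4" using j by (simp add: J_def)
    obtain a where "a \<in> J" using cardJ by fastforce
    have "card (J - {a}) = 3" using cardJ \<open>a \<in> J\<close> by simp
    then obtain b d e where bde: "J - {a} = {b, d, e}" "b \<noteq> d" "d \<noteq> e" "b \<noteq> e"
      by (auto simp: card_3_iff)
    then have Ja: "J = {a, b, d, e}" "a \<noteq> b" "a \<noteq> d" "a \<noteq> e" using \<open>a \<in> J\<close> by auto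
    have lt: "a < 5" "b < 5" "d < 5" "e < 5" using Ja(1) unfolding J_def by auto
    have "{a, b} \<in> ?T - ?U"
    proof (rule confI)
      have "{a, b} \<union> {d, e} = J" using Ja by auto
      moreover have "{d, e} \<in> ?T" using lt bde by (intro two_factor_interactionsI) auto
      moreover have "{d, e} \<noteq> {a, b}" using Ja bde by auto
      ultimately show "cols_dependent (gen_c 2 G) {a, b} \<or> cols_dependent (gen_r 2 G) {a, b} \<or>
         (\<exists>E'\<in>?T. E' \<noteq> {a, b} \<and> cols_dependent G ({a, b} \<union> E'))" using dep by metis
    qed (use lt Ja in auto)
    moreover have "{d, e} \<in> ?T - ?U"
    proof (rule confI)
      have "{d, e} \<union> {a, b} = J" using Ja by auto
      moreover have "{a, b} \<in> ?T" using lt Ja by (intro two_factor_interactionsI) auto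
      moreover have "{a, b} \<noteq> {d, e}" using Ja bde by auto
      ultimately show "cols_dependent (gen_c 2 G) {d, e} \<or> cols_dependent (gen_r 2 G) {d, e} \<or>
         (\<exists>E'\<in>?T. E' \<noteq> {d, e} \<and> cols_dependent G ({d, e} \<union> E'))" using dep by metis
    qed (use lt bde in auto)
    ultimately have "{a, b} = {d, e}" by (rule one)
    then show False using Ja bde by auto
  qed
  have zc: "w l * gen_c 2 G $$ (i, l) + w m * gen_c 2 G $$ (i, m) = 0" if "i < 2" for i
  proof (rule GF3_cancelling_pair[OF s c(1) nz(1) full _ lm _ that])
    show "(\<Sum>j<5. w j * gen_c 2 G $$ (i, j)) = 0" if "i < 2" for i
      using w(3)[of i] that by (simp add: c(2))
    show "{a, b} = {l, m}" if "a \<noteq> b" "a < 5" "b < 5" "cols_dependent (gen_c 2 G) {a, b}" for a b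
      by (rule one[OF confI lm_conf]) (use that in auto)
  qed
  have zr: "w l * gen_r 2 G $$ (i, l) + w m * gen_r 2 G $$ (i, m) = 0" if "i < 2" for i
  proof (rule GF3_cancelling_pair[OF s r(1) nz(2) full _ lm(1-3) lm_r _ that])
    show "(\<Sum>j<5. w j * gen_r 2 G $$ (i, j)) = 0" if "i < 2" for i
      using w(3)[of "2 + i"] that by (simp add: r(2))
    show "{a, b} = {l, m}" if "a \<noteq> b" "a < 5" "b < 5" "cols_dependent (gen_r 2 G) {a, b}" for a b
      by (rule one[OF confI lm_conf]) (use that in auto)
  qed
  have "w l * G $$ (i, l) + w m * G $$ (i, m) = 0" if "i < 4" for i
  proof (cases "i < 2")
    case True
    then show ?thesis using zc[OF True] c(2) lm by simp
  next
    case False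
    then have "i - 2 < 2" "2 + (i - 2) = i" using that by linarith+
    then show ?thesis using zr[of "i - 2"] r(2)[of "i - 2"] lm by simp
  qed
  then have "cols_dependent G {l, m}"
    unfolding cols_dependent_pair[OF lm(1)] using full[OF lm(2)] G by (intro exI[of _ "w l"] exI[of _ "w m"]) auto
  moreover have "unconfounded 2 G {l}"
    using main G lm main_effectsI[of l 5] by (auto simp: main_effects_unconfounded_def)
  moreover have "{m} \<in> main_effects (dim_col G)" "{m} \<noteq> {l}"
    using G lm main_effectsI[of m 5] by auto
  moreover have "{l} \<union> {m} = {l, m}" by auto
  ultimately show False by (metis UnI1 unconfounded_def confounded_with_effect_def)
qed

text \<open>
  The kernel is spanned by (1, 1, 2, 2, 1), so effects are not confounded with each other. The
  columns 2 and 4 share a slope in the upper half and the columns 0 and 4 in the lower half. The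
  other eight interactions are unconfounded, which meets the bound of
  \<open>GF3_num_unconfounded_2fi_le_8\<close>.
\<close>

lemma G_q2_optimal_3:
  assumes s: "CARD('s::prime_card) = 3"
  shows "yields_2fi_optimal 2 2 5 (G_q2 :: 's mod_ring mat)"
proof -
  define A B C :: "'s mod_ring mat" where "A = column [1, 2]" and "B = column [2, 0]" and "C = 0\<^sub>m 0 1"
  have st: "stacked 0 M0 A B C"
    by (auto simp: stacked_def A_def B_def C_def mat_of_cols_list_def)
  interpret stacked 0 M0 A B C by (rule st)
  have G: "G_q2 = G" using s by (simp add: G_q2_stacked A_def B_def C_def)
  have A: "A $$ (0, 0) = 1" "A $$ (Suc 0, 0) = 2" by (simp_all add: A_def)
  have B: "B $$ (0, 0) = 2" "B $$ (Suc 0, 0) = 0" by (simp_all add: B_def)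
  note GF3 = GF3_facts[OF s]
  have ind: "columns_independent_upto 4 G"
  proof (rule columns_independent_upto_if_weight)
    fix z j assume k: "\<forall>i<dim_row G. (\<Sum>j<dim_col G. z j * G $$ (i, j)) = 0" and j: "j < dim_col G" "z j \<noteq> 0"
    note K = kernel[OF k[unfolded dims]]
    have 2: "z 2 = - z 4" using K(2)[of 0] by (simp add: A B)
    have 3: "z 3 = 2 * z 4" using K(2)[of 1] by (simp add: A B)
    have 0: "z 0 = - 2 * z 4" using K(3)[of 0] by (simp add: A 2 3)
    have 1: "z 1 = - 2 * z 4" using K(3)[of 1] by (simp add: A 2 3)
    obtain j' where "j' < 0 + 1" "z (4 + j') \<noteq> 0"
      using k[unfolded dims] j[unfolded dims] by (rule kernel_tail_nonzero)
    then have "z 0 \<noteq> 0" "z 1 \<noteq> 0" "z 2 \<noteq> 0" "z 3 \<noteq> 0" "z 4 \<noteq> 0"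
      unfolding 0 1 2 3 using GF3(4) by simp_all
    then show "\<exists>S. finite S \<and> 4 < card S \<and> (\<forall>j\<in>S. z j \<noteq> 0)"
      by (intro five_nonzero[of 0 1 2 3 4]) simp_all
  qed
  have slopes: "col_slope G 0 = Some 0" "col_slope G 1 = None" "col_slope G 2 = Some 2"
    "col_slope G 3 = Some 1" "col_slope G 4 = Some 2"
    using col_slopes(1-4) col_slopes(5)[of 0] by (simp_all add: A slope_def)
  have c1: "\<not> cols_dependent (gen_c 2 G) {j}" if "j < 5" for j
    by (rule gen_c_columns_nonzero) (use that in \<open>simp_all add: A\<close>)
  have c: "\<not> cols_dependent (gen_c 2 G) {l, m}" if lm: "l < m" "m < 5" "(l, m) \<noteq> (2, 4)" for l m
  proof -
    have "col_slope G l \<noteq> col_slope G m"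
      using pairs_below_5[OF lm(1,2)] lm(3) slopes GF3(4,5)
      by (elim disjE conjE) (simp_all add: GF3(4,5)[symmetric])
    then show ?thesis using cols_dependent_gen_c_pair[of l m G] c1 lm by simp
  qed
  have six: "(6 :: 's mod_ring) = 0" "(4 :: 's mod_ring) = 1"
  proof -
    have "(3 :: 's mod_ring) + 3 = 0" "(3 :: 's mod_ring) + 1 = 1" by (simp_all only: GF3(6)) simp_all
    then show "(6 :: 's mod_ring) = 0" "(4 :: 's mod_ring) = 1" by simp_all
  qed
  have r: "\<not> cols_dependent (gen_r 2 G) {l, m}" if lm: "l < m" "m < 5" "(l, m) \<noteq> (0, 4)" for l m
  proof (rule gen_r_pair_independent_if_minor[where i=2 and i'=3])
    show "G $$ (2, l) * G $$ (3, m) \<noteq> G $$ (3, l) * G $$ (2, m)"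
      using pairs_below_5[OF lm(1,2)] lm(3) entries_r_head B GF3(4,5) six
      by (elim disjE conjE) (simp_all add: GF3(4,5)[symmetric])
  qed (use lm in simp_all)
  have r1: "\<not> cols_dependent (gen_r 2 G) {j}" if "j < 5" for j
    using independent_if_pair_independent[OF r[of j 3]]
      independent_if_pair_independent[OF r[of 3 4]] that
    by (cases "j < 3"; cases "j = 3"; cases "j = 4") simp_all
  have main: "main_effects_unconfounded 2 G"
    using ind c1 r1 by (intro main_effects_unconfoundedI) simp_all
  have eight: "8 \<le> num_unconfounded_2fi 2 G"
  proof -
    let ?T = "two_factor_interactions 5"
    have "?T - {{0, 4}, {2, 4}} \<subseteq> {E \<in> two_factor_interactions (dim_col G). unconfounded 2 G E}"
    proof
      fix E assume E: "E \<in> ?T - {{0, 4}, {2, 4}}"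
      then have "E \<in> ?T" by blast
      then obtain l m where lm: "E = {l, m}" "l < m" "m < 5" by (rule two_factor_interactionsE)
      have "(l, m) \<noteq> (2, 4)" "(l, m) \<noteq> (0, 4)" using E lm by auto
      then show "E \<in> {E \<in> two_factor_interactions (dim_col G). unconfounded 2 G E}"
        using E lm c[of l m] r[of l m] unconfounded_if_columns_independent[OF ind, of E 2] by simp
    qed
    then have "card (?T - {{0, 4}, {2, 4}}) \<le> num_unconfounded_2fi 2 G"
      unfolding num_unconfounded_2fi_def by (intro card_mono) auto
    moreover have "card (?T - {{0, 4}, {2, 4}}) = 8"
    proof -
      have "{{0, 4}, {2, 4}} \<subseteq> ?T" by (simp add: two_factor_interactionsI)
      moreover have "card {{0, 4}, {2, 4::nat}} = 2" by (simp add: doubleton_eq_iff)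
      moreover have "card ?T = 10" by (simp add: card_two_factor_interactions choose_two)
      ultimately show ?thesis by (simp add: card_Diff_subset)
    qed
    ultimately show ?thesis by simp
  qed
  have "vec_space.rank (0 + 4) G = 0 + 4" by (rule rank) simp
  then have gen: "array_generator 2 2 5 G"
    using carrier by (simp add: array_generator_def)
  have "num_unconfounded_2fi 2 G' \<le> num_unconfounded_2fi 2 G"
    if "array_generator 2 2 5 G'" "main_effects_unconfounded 2 G'" for G' :: "'s mod_ring mat"
    using GF3_num_unconfounded_2fi_le_8[OF s _ that(2)] that(1) eight by (simp add: array_generator_def)
  with gen main show ?thesis by (simp add: yields_2fi_optimal_def G)
qed

section \<open>Points of the projective line\<close>

lemma finite_carrier_vec_finite_type: "finite (carrier_vec m :: 'a::finite vec set)"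
proof -
  have "carrier_vec m \<subseteq> vec_of_list ` {xs :: 'a list. set xs \<subseteq> UNIV \<and> length xs = m}"
  proof
    fix v :: "'a vec" assume "v \<in> carrier_vec m"
    then show "v \<in> vec_of_list ` {xs. set xs \<subseteq> UNIV \<and> length xs = m}"
      by (intro image_eqI[of _ _ "list_of_vec v"]) (auto simp: vec_list)
  qed
  then show ?thesis
    using finite_surj[OF finite_lists_length_eq[of "UNIV :: 'a set" m]] by simp
qed

text \<open>
  A point is the span of any nonzero vector in it. For the inclusion from left to right, the
  dimension is defined by finite generating sets; over a finite field the subspace itself is
  one, so a finite basis exists, and it has a single element.
\<close>

lemma PG_points_eq:
  "PG_points m = {{c \<cdot>\<^sub>v b |c. True} |b. b \<in> carrier_vec m \<and> b \<noteq> (0\<^sub>v m :: 's::prime_card mod_ring vec)}"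
proof -
  interpret vec_space "TYPE('s mod_ring)" m .
  have span_line: "span {b} = {c \<cdot>\<^sub>v b |c. True}" if b: "b \<in> carrier_vec m" for b
  proof -
    have "lincomb a {b} = a b \<cdot>\<^sub>v b" for a
      using b by (simp add: lincomb_def)
    then have "span {b} = {a b \<cdot>\<^sub>v b |a. True}"
      using finite_span[of "{b}"] b by auto
    also have "\<dots> = {c \<cdot>\<^sub>v b |c. True}"
    proof (intro equalityI subsetI)
      fix x assume "x \<in> {c \<cdot>\<^sub>v b |c. True}"
      then obtain c where "x = c \<cdot>\<^sub>v b" by auto
      then show "x \<in> {a b \<cdot>\<^sub>v b |a. True}" by (intro CollectI exI[of _ "\<lambda>_. c"]) simp
    qed auto
    finally show ?thesis .
  qed
  have line: "W \<in> PG_points m" if b: "b \<in> carrier_vec m" "b \<noteq> 0\<^sub>v m" and W: "W = span {b}" for W b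
  proof -
    have sub: "VectorSpace.subspace class_ring W V"
      unfolding W using span_is_subspace[of "{b}"] b by simp
    interpret W: vectorspace class_ring "V\<lparr>carrier := W\<rparr>"
      by (rule subspace_is_vs[OF sub])
    have "b = 1 \<cdot>\<^sub>v b" by simp
    then have "b \<in> W" unfolding W span_line[OF b(1)] by blast
    have "W.span {b} = W"
      using span_li_not_depend(1)[OF _ is_module[OF sub], of "{b}"] \<open>b \<in> W\<close> unfolding W by blast
    then have "W.dim = 1"
      by (intro W.dim1I[of b]) (use b \<open>b \<in> W\<close> in simp_all)
    with sub show ?thesis unfolding PG_points_def by blast
  qed
  have point: "\<exists>b. b \<in> carrier_vec m \<and> b \<noteq> 0\<^sub>v m \<and> W = span {b}" if W: "W \<in> PG_points m" for W
  proof -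
    have sub: "VectorSpace.subspace class_ring W V"
      and dim: "vectorspace.dim class_ring (V\<lparr>carrier := W\<rparr>) = 1"
      using W by (auto simp: PG_points_def)
    interpret W: vectorspace class_ring "V\<lparr>carrier := W\<rparr>"
      by (rule subspace_is_vs[OF sub])
    have WV: "W \<subseteq> carrier_vec m"
      using is_module[OF sub] by (auto simp: submodule_def)
    have fin: "finite W" by (rule finite_subset[OF WV finite_carrier_vec_finite_type])
    have "W.span W = W"
      using W.in_own_span[of W] W.span_is_subset2[of W] by auto
    then have "W.fin_dim"
      unfolding W.fin_dim_def using fin by (intro exI[of _ W]) simp
    then obtain B where B: "finite B" "W.basis B" using W.finite_basis_exists by blast
    then have "card B = 1" using W.dim_basis dim by simp
    then obtain b where b: "B = {b}" by (rule card_1_singletonE)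
    have bW: "b \<in> W" "W.span {b} = W" "W.lin_indpt {b}"
      using B b by (auto simp: W.basis_def)
    have "W.span {b} = span {b}"
      using span_li_not_depend(1)[OF _ is_module[OF sub], of "{b}"] bW(1) by blast
    moreover have "b \<noteq> 0\<^sub>v m"
      using bW(3) W.vs_zero_lin_dep[of "{b}"] bW(1) by auto
    ultimately show ?thesis using bW(1,2) WV by blast
  qed
  show ?thesis
  proof (intro equalityI subsetI)
    fix W :: "'s mod_ring vec set" assume "W \<in> PG_points m"
    then obtain b where b: "b \<in> carrier_vec m" "b \<noteq> 0\<^sub>v m" "W = span {b}" using point by blast
    then show "W \<in> {{c \<cdot>\<^sub>v b |c. True} |b. b \<in> carrier_vec m \<and> b \<noteq> 0\<^sub>v m}"
      unfolding mem_Collect_eq using span_line[OF b(1)] by (intro exI[of _ b]) simp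
  next
    fix W :: "'s mod_ring vec set"
    assume "W \<in> {{c \<cdot>\<^sub>v b |c. True} |b. b \<in> carrier_vec m \<and> b \<noteq> 0\<^sub>v m}"
    then obtain b where b: "b \<in> carrier_vec m" "b \<noteq> 0\<^sub>v m" "W = {c \<cdot>\<^sub>v b |c. True}" by blast
    then show "W \<in> PG_points m" using line[OF b(1,2)] span_line[OF b(1)] by simp
  qed
qed

definition slope_line :: "'a::field option \<Rightarrow> 'a vec set" where
  "slope_line t = {v \<in> carrier_vec 2. v = 0\<^sub>v 2 \<or> slope (v $ 0) (v $ 1) = t}"

lemma vec2_eq_iff:
  assumes "u \<in> carrier_vec 2" "v \<in> carrier_vec 2"
  shows "u = v \<longleftrightarrow> u $ 0 = v $ 0 \<and> u $ 1 = v $ 1"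
  using assms by (auto simp: vec_eq_iff less_2_cases_iff)

lemma multiples_eq_slope_line:
  fixes b :: "'a::field vec"
  assumes b: "b \<in> carrier_vec 2" "b \<noteq> 0\<^sub>v 2"
  shows "{c \<cdot>\<^sub>v b |c. True} = slope_line (slope (b $ 0) (b $ 1))"
proof (intro equalityI subsetI)
  fix v assume "v \<in> {c \<cdot>\<^sub>v b |c. True}"
  then obtain c where v: "v = c \<cdot>\<^sub>v b" by auto
  show "v \<in> slope_line (slope (b $ 0) (b $ 1))"
    using b(1) by (cases "c = 0") (auto simp: v slope_line_def slope_def vec2_eq_iff)
next
  fix v assume v: "v \<in> slope_line (slope (b $ 0) (b $ 1))"
  then have vc: "v \<in> carrier_vec 2" by (simp add: slope_line_def)
  show "v \<in> {c \<cdot>\<^sub>v b |c. True}"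
  proof (cases "v = 0\<^sub>v 2")
    case True
    then have "v = 0 \<cdot>\<^sub>v b" using b by (simp add: vec2_eq_iff)
    then show ?thesis by blast
  next
    case False
    then have "slope (v $ 0) (v $ 1) = slope (b $ 0) (b $ 1)" using v by (simp add: slope_line_def)
    moreover have "v $ 0 \<noteq> 0 \<or> v $ 1 \<noteq> 0" "b $ 0 \<noteq> 0 \<or> b $ 1 \<noteq> 0"
      using False b vc by (auto simp: vec2_eq_iff)
    ultimately have e: "v $ 0 * b $ 1 = b $ 0 * v $ 1" by (simp add: slope_eq_iff)
    have "\<exists>c. v $ 0 = c * b $ 0 \<and> v $ 1 = c * b $ 1"
    proof (cases "b $ 0 = 0")
      case True
      with e \<open>b $ 0 \<noteq> 0 \<or> b $ 1 \<noteq> 0\<close> show ?thesis by (intro exI[of _ "v $ 1 / b $ 1"]) simp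
    next
      case False
      with e show ?thesis by (intro exI[of _ "v $ 0 / b $ 0"]) (simp add: mult.commute)
    qed
    then obtain c where "v $ 0 = c * b $ 0" "v $ 1 = c * b $ 1" by blast
    then have "v = c \<cdot>\<^sub>v b" using vc b by (simp add: vec2_eq_iff)
    then show ?thesis by blast
  qed
qed

definition slope_vec :: "'a::field option \<Rightarrow> 'a vec" where
  "slope_vec t = (case t of None \<Rightarrow> unit_vec 2 1 | Some u \<Rightarrow> vec 2 (\<lambda>i. if i = 0 then 1 else u))"

lemma slope_vec:
  "slope_vec t \<in> carrier_vec 2" "slope_vec t $ 0 \<noteq> 0 \<or> slope_vec t $ 1 \<noteq> 0"
  "slope (slope_vec t $ 0) (slope_vec t $ 1) = t"
  by (auto simp: slope_vec_def slope_def split: option.splits)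

text \<open>
  The condition on the matrix X speaks of subspaces; this lemma turns it into one on slopes.
\<close>

lemma PG_points_2_eq: "PG_points 2 = range (slope_line :: 's::prime_card mod_ring option \<Rightarrow> _)"
proof (intro equalityI subsetI)
  fix W :: "'s mod_ring vec set" assume "W \<in> PG_points 2"
  then obtain b where "b \<in> carrier_vec 2" "b \<noteq> 0\<^sub>v 2" "W = {c \<cdot>\<^sub>v b |c. True}"
    unfolding PG_points_eq by blast
  then show "W \<in> range slope_line" using multiples_eq_slope_line[of b] by simp
next
  fix W :: "'s mod_ring vec set" assume "W \<in> range slope_line"
  then obtain t where W: "W = slope_line t" by blast
  have b: "slope_vec t \<in> carrier_vec 2" "slope_vec t \<noteq> 0\<^sub>v 2"
    using slope_vec(1,2)[of t] by auto
  have "W = {c \<cdot>\<^sub>v slope_vec t |c. True}"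
    using multiples_eq_slope_line[OF b] slope_vec(3)[of t] W by simp
  then show "W \<in> PG_points 2" unfolding PG_points_eq using b by blast
qed

lemma appearances_slope_line:
  fixes A :: "'s::prime_card mod_ring mat"
  assumes A: "A \<in> carrier_mat 2 n" and nz: "\<And>j. j < n \<Longrightarrow> A $$ (0, j) \<noteq> 0 \<or> A $$ (1, j) \<noteq> 0"
  shows "appearances A (slope_line t) = card {j. j < n \<and> col_slope A j = t}"
proof -
  have "col A j \<noteq> 0\<^sub>v 2 \<and> col A j \<in> slope_line t \<longleftrightarrow> col_slope A j = t" if "j < n" for j
  proof -
    have "col A j \<noteq> 0\<^sub>v 2" "col A j \<in> carrier_vec 2" "col A j $ 0 = A $$ (0, j)" "col A j $ 1 = A $$ (1, j)"
      using A nz[OF that] that by (auto simp: vec2_eq_iff)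
    then show ?thesis by (simp add: slope_line_def col_slope_def)
  qed
  then have "{j. j < n \<and> col A j \<noteq> 0\<^sub>v 2 \<and> col A j \<in> slope_line t} = {j. j < n \<and> col_slope A j = t}"
    by blast
  then show ?thesis using A by (simp add: appearances_def)
qed

abbreviation ge5_top :: "'s::prime_card mod_ring mat \<Rightarrow> 's mod_ring mat" where
  "ge5_top X \<equiv> 1\<^sub>m 2 @\<^sub>c M0 @\<^sub>c a_ge5 @\<^sub>c X"

lemma ge5_top_carrier:
  "X \<in> carrier_mat 2 k \<Longrightarrow> ge5_top X \<in> carrier_mat 2 (k + 5)"
  by (auto intro!: carrier_matI)

lemma ge5_top_entries:
  fixes X :: "'s::prime_card mod_ring mat"
  assumes X: "X \<in> carrier_mat 2 k"
  shows "ge5_top X $$ (0, 0) = 1" "ge5_top X $$ (1, 0) = 0" "ge5_top X $$ (0, 1) = 0" "ge5_top X $$ (1, 1) = 1"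
    "ge5_top X $$ (0, 2) = 1" "ge5_top X $$ (1, 2) = 2" "ge5_top X $$ (0, 3) = 1" "ge5_top X $$ (1, 3) = 1"
    "ge5_top X $$ (0, 4) = 1" "ge5_top X $$ (1, 4) = -1"
    "i < 2 \<Longrightarrow> j < k \<Longrightarrow> ge5_top X $$ (i, 5 + j) = X $$ (i, j)"
  using X by (simp_all add: append_cols_index)

lemma ge5_top_slopes:
  fixes X :: "'s::prime_card mod_ring mat"
  assumes X: "X \<in> carrier_mat 2 k"
  shows "map (col_slope (ge5_top X)) [0..<k + 5] =
    [Some 0, None, Some 2, Some 1, Some (-1)] @ map (col_slope X) [0..<k]"
proof -
  have "[0..<k + 5] = [0, 1, 2, 3, 4] @ map (\<lambda>j. 5 + j) [0..<k]"
    using upt_add_eq_append[of 0 5 k] map_add_upt[of 5 k] by (simp add: add.commute upt_rec)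
  then show ?thesis
    using ge5_top_entries[OF X] by (simp add: col_slope_def slope_def comp_def)
qed

lemma ge5_top_nonzero:
  fixes X :: "'s::prime_card mod_ring mat"
  assumes X: "X \<in> carrier_mat 2 k" and X0: "\<And>j. j < k \<Longrightarrow> X $$ (0, j) \<noteq> 0 \<or> X $$ (1, j) \<noteq> 0"
    and j: "j < k + 5"
  shows "ge5_top X $$ (0, j) \<noteq> 0 \<or> ge5_top X $$ (1, j) \<noteq> 0"
proof -
  have "j = 0 \<or> j = 1 \<or> j = 2 \<or> j = 3 \<or> j = 4 \<or> j = 5 + (j - 5) \<and> j - 5 < k" using j by linarith
  then show ?thesis
  proof (elim disjE)
    assume "j = 5 + (j - 5) \<and> j - 5 < k"
    then obtain i where i: "j = 5 + i" "i < k" by blast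
    show ?thesis unfolding i(1) using ge5_top_entries(11)[OF X _ i(2)] X0[OF i(2)] by simp
  qed (use ge5_top_entries[OF X] in simp_all)
qed

lemma admissible_X_iff:
  fixes X :: "'s::prime_card mod_ring mat"
  shows "admissible_X (k + 2) X \<longleftrightarrow>
    X \<in> carrier_mat 2 k \<and> (\<forall>j<k. X $$ (0, j) \<noteq> 0 \<or> X $$ (1, j) \<noteq> 0) \<and>
    (\<forall>t. card {j. j < k + 5 \<and> col_slope (ge5_top X) j = t}
      \<in> {(k + 5) div (CARD('s) + 1), (k + 5) div (CARD('s) + 1) + 1})"
proof (cases "X \<in> carrier_mat 2 k")
  case X: True
  have col: "col X j \<noteq> 0\<^sub>v 2 \<longleftrightarrow> X $$ (0, j) \<noteq> 0 \<or> X $$ (1, j) \<noteq> 0" if "j < k" for j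
    using X that by (subst vec2_eq_iff) auto
  show ?thesis
  proof (cases "\<forall>j<k. X $$ (0, j) \<noteq> 0 \<or> X $$ (1, j) \<noteq> 0")
    case True
    have "appearances (ge5_top X) (slope_line t) = card {j. j < k + 5 \<and> col_slope (ge5_top X) j = t}" for t
      using ge5_top_carrier[OF X] ge5_top_nonzero[OF X] True by (intro appearances_slope_line) auto
    moreover have n: "2 + (k + 2) + 1 = k + 5" "k + 2 - 2 = k" by simp_all
    ultimately show ?thesis
      unfolding admissible_X_def Let_def PG_points_2_eq n using X True col by simp
  qed (use X col in \<open>auto simp: admissible_X_def\<close>)
qed (auto simp: admissible_X_def)

section \<open>Existence of an even completion\<close>

text \<open>
  The fibre condition of \<open>optimal_if_balanced\<close> for a list of points. Counts in {a, a + 1} that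
  add up to the length force a to be this quotient, unless all counts are a + 1.
\<close>

definition balanced_list :: "'k::finite list \<Rightarrow> bool" where
  "balanced_list xs \<longleftrightarrow>
     (\<forall>t. count_list xs t \<in> {length xs div CARD('k), length xs div CARD('k) + 1})"

text \<open>
  The new element is a value of minimal count; it exists because the counts add up to the
  length. If the quotient increases with the new element, then the length is a multiple of the
  number of values, and counts bounded by the new quotient with this sum are all equal to it.
\<close>

lemma balanced_list_extend:
  fixes xs :: "'k::finite list"
  assumes bal: "balanced_list xs"
  shows "\<exists>t. balanced_list (xs @ [t])"
proof -
  define K where "K = CARD('k)"
  define a where "a = length xs div K"
  have K: "K > 0" by (simp add: K_def)
  have sum: "(\<Sum>t\<in>UNIV. count_list ys t) = length ys" for ys :: "'k list"
    by (rule sum_count_set) auto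
  have c: "count_list xs t = a \<or> count_list xs t = a + 1" for t
    using bal by (auto simp: balanced_list_def a_def K_def)
  have "\<exists>t. count_list xs t = a"
  proof (rule ccontr)
    assume "\<nexists>t. count_list xs t = a"
    then have "count_list xs t = a + 1" for t using c by blast
    then have "length xs = K * (a + 1)" using sum[of xs] by (simp add: K_def)
    then have "length xs div K = a + 1" using K by simp
    then show False by (simp add: a_def)
  qed
  then obtain t where t: "count_list xs t = a" by blast
  have up: "count_list (xs @ [t]) u \<in> {a, a + 1}" for u using c[of u] t by auto
  have "balanced_list (xs @ [t])"
  proof (cases "Suc (length xs) mod K = 0")
    case False
    then have "length (xs @ [t]) div K = a" by (simp add: div_Suc a_def)
    then show ?thesis using up by (simp add: balanced_list_def K_def)
  next
    case True
    then have d: "length (xs @ [t]) div K = a + 1" by (simp add: div_Suc a_def)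
    then have len: "length (xs @ [t]) = K * (a + 1)" using True
      by (metis One_nat_def add.right_neutral add_Suc_right length_append list.size(3,4) mult_div_mod_eq)
    have "count_list (xs @ [t]) u = a + 1" for u
    proof (rule ccontr)
      assume "count_list (xs @ [t]) u \<noteq> a + 1"
      then have "count_list (xs @ [t]) u < a + 1" using up[of u] by auto
      moreover have "count_list (xs @ [t]) v \<le> a + 1" for v using up[of v] by auto
      ultimately have "(\<Sum>v\<in>UNIV. count_list (xs @ [t]) v) < (\<Sum>v\<in>(UNIV :: 'k set). a + 1)"
        by (intro sum_strict_mono_ex1 ballI bexI[of _ u]) simp_all
      then show False unfolding sum len by (simp add: K_def)
    qed
    then show ?thesis using d by (simp add: balanced_list_def K_def)
  qed
  then show ?thesis by blast
qed

lemma balanced_list_extend_by: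
  fixes xs :: "'k::finite list"
  assumes "balanced_list xs"
  shows "\<exists>ys. length ys = m \<and> balanced_list (xs @ ys)"
proof (induction m)
  case 0
  then show ?case using assms by simp
next
  case (Suc m)
  then obtain ys where ys: "length ys = m" "balanced_list (xs @ ys)" by blast
  then obtain t where "balanced_list ((xs @ ys) @ [t])" using balanced_list_extend by blast
  then show ?case using ys(1) by (intro exI[of _ "ys @ [t]"]) simp
qed

lemma count_list_eq_filter: "count_list xs t = length (filter (\<lambda>x. x = t) xs)"
  by (induction xs) auto

lemma count_list_le_one: "distinct xs \<Longrightarrow> count_list xs t \<le> 1"
  by (induction xs) auto

text \<open>
  For s at least 5 the five given slopes are distinct and thus evenly distributed. Over GF(3)
  the slope 2 = -1 occurs twice among them, and one more copy of each of the three other points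
  makes the distribution even; this is where k must be at least 3.
\<close>

lemma balanced_start:
  assumes odd: "odd (CARD('s::prime_card))" and k: "3 \<le> k"
  shows "\<exists>ys. length ys = k \<and>
    balanced_list ([Some 0, None, Some 2, Some 1, Some (-1)] @ (ys :: 's mod_ring option list))"
proof (cases "CARD('s) = 3")
  case True
  note GF3 = GF3_facts[OF True]
  let ?xs = "[Some 0, None, Some 2, Some 1, Some (-1), Some 0, None, Some 1] :: 's mod_ring option list"
  have "count_list ?xs t = 2" for t
  proof -
    have "t \<in> {None, Some 0, Some 1, Some 2}" using GF3(1) by (cases t) auto
    then show ?thesis using GF3(4,5) by (elim insertE) (simp_all add: GF3(3) GF3(4,5)[symmetric])
  qed
  then have "balanced_list ?xs" by (simp add: balanced_list_def True)
  then obtain ys where "length ys = k - 3" "balanced_list (?xs @ ys)"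
    using balanced_list_extend_by by blast
  then show ?thesis using k by (intro exI[of _ "[Some 0, None, Some 1] @ ys"]) simp
next
  case False
  then have s: "5 \<le> CARD('s)" using odd_CARD_cases[OF odd] by auto
  let ?xs = "[Some 0, None, Some 2, Some 1, Some (-1)] :: 's mod_ring option list"
  have "distinct ?xs"
    using s by (simp add: numeral_mod_ring_eq numeral_mod_ring_eq_one numeral_mod_ring_neq_zero
        neg_eq_iff_add_eq_0 eq_neg_iff_add_eq_0 one_eq_numeral_mod_ring)
  then have "count_list ?xs t \<le> 1" for t
    by (rule count_list_le_one)
  moreover have "m \<in> {0, 0 + 1}" if "m \<le> 1" for m :: nat using that by auto
  ultimately have "count_list ?xs t \<in> {0, 0 + 1}" for t by blast
  then have "balanced_list ?xs" using s by (simp add: balanced_list_def)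
  then show ?thesis using balanced_list_extend_by by blast
qed

lemma admissible_X_exists:
  assumes odd: "odd (CARD('s::prime_card))" and k: "3 \<le> k"
  shows "\<exists>X :: 's mod_ring mat. admissible_X (k + 2) X"
proof -
  obtain ys :: "'s mod_ring option list" where ys: "length ys = k"
      "balanced_list ([Some 0, None, Some 2, Some 1, Some (-1)] @ ys)"
    using balanced_start[OF odd k] by blast
  define X where "X = mat 2 k (\<lambda>(i, j). slope_vec (ys ! j) $ i)"
  have X: "X \<in> carrier_mat 2 k" by (simp add: X_def)
  have slopes: "map (col_slope X) [0..<k] = ys"
    using ys(1) slope_vec(3) by (intro nth_equalityI) (auto simp: col_slope_def X_def)
  have "card {j. j < k + 5 \<and> col_slope (ge5_top X) j = t}
      \<in> {(k + 5) div (CARD('s) + 1), (k + 5) div (CARD('s) + 1) + 1}" for t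
  proof -
    have "card {j. j < k + 5 \<and> col_slope (ge5_top X) j = t} =
        count_list ([Some 0, None, Some 2, Some 1, Some (-1)] @ ys) t"
      unfolding card_fibre_eq_count ge5_top_slopes[OF X] slopes count_list_eq_filter ..
    also have "\<dots> \<in> {(k + 5) div (CARD('s) + 1), (k + 5) div (CARD('s) + 1) + 1}"
    proof -
      have "length ([Some 0, None, Some 2, Some 1, Some (-1)] @ ys) = k + 5" using ys(1) by simp
      moreover have "CARD('s mod_ring option) = CARD('s) + 1" by simp
      ultimately show ?thesis
        using ys(2) by (simp only: balanced_list_def)
    qed
    finally show ?thesis .
  qed
  moreover have "X $$ (0, j) \<noteq> 0 \<or> X $$ (1, j) \<noteq> 0" if "j < k" for j
    using that slope_vec(2) by (simp add: X_def)
  ultimately have "admissible_X (k + 2) X"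
    unfolding admissible_X_iff using X by blast
  then show ?thesis ..
qed

lemma G_ge5_optimal_if_admissible:
  fixes X :: "'s::prime_card mod_ring mat"
  assumes odd: "odd (CARD('s))" and k: "3 \<le> k" and adm: "admissible_X (k + 2) X"
  shows "yields_2fi_optimal 2 (k + 2) (k + 5) (G_ge5 (k + 2) X)"
proof -
  have X: "X \<in> carrier_mat 2 k" and X0: "\<And>j. j < k \<Longrightarrow> X $$ (0, j) \<noteq> 0 \<or> X $$ (1, j) \<noteq> 0"
    and bal: "\<And>t. card {j. j < k + 5 \<and> col_slope (ge5_top X) j = t}
      \<in> {(k + 5) div (CARD('s) + 1), (k + 5) div (CARD('s) + 1) + 1}"
    using adm unfolding admissible_X_iff by blast+
  have "col_slope (G_ge5 (k + 2) X) j = col_slope (ge5_top X) j" if "j < k + 5" for j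
    using X that by (simp add: col_slope_def G_ge5_def append_rows_index)
  then have "{j. j < k + 5 \<and> col_slope (G_ge5 (k + 2) X) j = t} =
      {j. j < k + 5 \<and> col_slope (ge5_top X) j = t}" for t by auto
  then show ?thesis
    using bal by (intro G_ge5_optimal[OF odd k X X0, where a = "(k + 5) div (CARD('s) + 1)"]) simp_all
qed

section \<open>Optimality of the generators\<close>

theorem theorem10:
  fixes q n :: nat
  assumes "odd (CARD('s::prime_card))"
    and "q \<ge> 2"
    and "n = 2 + q + 1"
  shows "(q = 2 \<longrightarrow> yields_2fi_optimal 2 q n (G_q2 :: 's mod_ring mat)) \<and>
         (q = 3 \<longrightarrow> yields_2fi_optimal 2 q n (G_q3 :: 's mod_ring mat)) \<and>
         (q = 4 \<longrightarrow> yields_2fi_optimal 2 q n (G_q4 :: 's mod_ring mat)) \<and>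
         (q \<ge> 5 \<longrightarrow>
            (\<exists>X :: 's mod_ring mat. admissible_X q X) \<and>
            (\<forall>X :: 's mod_ring mat. admissible_X q X \<longrightarrow> yields_2fi_optimal 2 q n (G_ge5 q X)))"
proof (intro conjI impI allI)
  show "yields_2fi_optimal 2 q n (G_q2 :: 's mod_ring mat)" if "q = 2"
  proof (cases "CARD('s) = 3")
    case True
    then show ?thesis using that assms(3) G_q2_optimal_3 by simp
  next
    case False
    then have "5 \<le> CARD('s)" using odd_CARD_cases[OF assms(1)] by auto
    then show ?thesis using that assms(3) G_q2_optimal_ge5 by simp
  qed
  show "yields_2fi_optimal 2 q n (G_q3 :: 's mod_ring mat)" if "q = 3"
    using that assms(3) G_q3_optimal[OF assms(1)] by simp
  show "yields_2fi_optimal 2 q n (G_q4 :: 's mod_ring mat)" if "q = 4"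
    using that assms(3) G_q4_optimal[OF assms(1)] by simp
  assume "5 \<le> q"
  then have "q = (q - 2) + 2 \<and> 3 \<le> q - 2" by linarith
  then obtain k where k: "q = k + 2" "3 \<le> k" by blast
  have n: "n = k + 5" using assms(3) k by simp
  show "\<exists>X :: 's mod_ring mat. admissible_X q X"
    unfolding k(1) by (rule admissible_X_exists[OF assms(1) k(2)])
  show "yields_2fi_optimal 2 q n (G_ge5 q X)" if "admissible_X q X" for X :: "'s mod_ring mat"
    using that unfolding k(1) n by (rule G_ge5_optimal_if_admissible[OF assms(1) k(2)])
qed

end
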